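(* There exists a constant $c>0$ such that for all sufficiently large $n$, $$W_n \;\geq\; 2^{c\, 2^{2n/5}},$$ i.e. $W_n \geq 2^{\Omega(2^{2n/5})}$.
   Context: For a Boolean function $f\colon\{0,1\}^n\to\{0,1\}$, a threshold gate for $f$ is a polynomial $p$ with integer coefficients in $n$ variables such that for all $x\in\{0,1\}^n$, $f(x)=1$ if and only if $p(x)\ge 0$. The weight $W(p)$ of $p$ is the sum of the absolute values of its coefficients. The threshold degree $\deg_{\pm}(f)$ is the minimal degree of a threshold gate for $f$. For $d\ge \deg_{\pm}(f)$, $W(f,d)$ denotes the minimal weight of a threshold gate for $f$ of degree at most $d$. Define $$W_n=\max_{d}\ \max_{f\colon\{0,1\}^n\to\{0,1\},\ \deg_{\pm}(f)\le d} W(f,d).$$ *)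

theory Defs
  imports Complex_Main "HOL-Library.FuncSet" "HOL-Library.Poly_Mapping"
begin

text \<open>
  A polynomial with integer coefficients is a finitely supported map from monomials to
  coefficients, a monomial being a finitely supported map from variable indices to exponents.
  Polynomials in \<open>n\<close> variables use only the indices \<open>0, \<dots>, n - 1\<close>. They are not required
  to be multilinear.
\<close>

type_synonym int_mpoly = "(nat \<Rightarrow>\<^sub>0 nat) \<Rightarrow>\<^sub>0 int"

definition mpoly_vars :: "int_mpoly \<Rightarrow> nat set" where
  "mpoly_vars p = (\<Union>m\<in>Poly_Mapping.keys p. Poly_Mapping.keys m)"

definition mpoly_eval :: "int_mpoly \<Rightarrow> (nat \<Rightarrow> int) \<Rightarrow> int" where
  "mpoly_eval p x = (\<Sum>m\<in>Poly_Mapping.keys p.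
     Poly_Mapping.lookup p m * (\<Prod>i\<in>Poly_Mapping.keys m. x i ^ Poly_Mapping.lookup m i))"

definition monom_degree :: "(nat \<Rightarrow>\<^sub>0 nat) \<Rightarrow> nat" where
  "monom_degree m = (\<Sum>i\<in>Poly_Mapping.keys m. Poly_Mapping.lookup m i)"

text \<open>Total degree; the zero polynomial has degree 0.\<close>

definition mpoly_degree :: "int_mpoly \<Rightarrow> nat" where
  "mpoly_degree p = Max (insert 0 (monom_degree ` Poly_Mapping.keys p))"

definition weight :: "int_mpoly \<Rightarrow> nat" where
  "weight p = (\<Sum>m\<in>Poly_Mapping.keys p. nat \<bar>Poly_Mapping.lookup p m\<bar>)"

definition cube :: "nat \<Rightarrow> (nat \<Rightarrow> int) set" where
  "cube n = {..<n} \<rightarrow>\<^sub>E {0, 1}"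

definition boolean_functions :: "nat \<Rightarrow> ((nat \<Rightarrow> int) \<Rightarrow> int) set" where
  "boolean_functions n = cube n \<rightarrow>\<^sub>E {0, 1}"

definition threshold_gate :: "nat \<Rightarrow> ((nat \<Rightarrow> int) \<Rightarrow> int) \<Rightarrow> int_mpoly \<Rightarrow> bool" where
  "threshold_gate n f p \<longleftrightarrow>
     mpoly_vars p \<subseteq> {..<n} \<and> (\<forall>x\<in>cube n. f x = 1 \<longleftrightarrow> mpoly_eval p x \<ge> 0)"

definition threshold_degree :: "nat \<Rightarrow> ((nat \<Rightarrow> int) \<Rightarrow> int) \<Rightarrow> nat" where
  "threshold_degree n f = (LEAST k. \<exists>p. threshold_gate n f p \<and> mpoly_degree p = k)"

definition min_weight :: "nat \<Rightarrow> ((nat \<Rightarrow> int) \<Rightarrow> int) \<Rightarrow> nat \<Rightarrow> nat" where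
  "min_weight n f d =
     (LEAST w. \<exists>p. threshold_gate n f p \<and> mpoly_degree p \<le> d \<and> weight p = w)"

text \<open>
  Although \<open>d\<close> is unbounded, the maximum is over a finite set: there are finitely many \<open>f\<close>, and
  for each of them the minimal weight is a nonincreasing function of \<open>d\<close>.
\<close>

definition max_weight :: "nat \<Rightarrow> nat" where
  "max_weight n =
     Max {min_weight n f d | d f. f \<in> boolean_functions n \<and> threshold_degree n f \<le> d}"

end

theory Submission
  imports Defs
begin

text \<open>
  A polynomial of degree less than \<open>D\<close> has alternating sum \<open>0\<close> over every subcube of dimension \<open>D\<close>.
  Hence if, up to the parity sign, \<open>p\<close> has one sign on a \<open>D\<close>-dimensional subcube except at one
  exceptional point, the value there dominates the sum of all the others. We chain about \<open>2 * Q ^ M\<close>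
  pairs of subcubes so that the exceptional point of one is an ordinary point of the next; the values
  along the chain double at every second step, so every \<open>p\<close> with this sign pattern has a value, hence a
  weight, of at least \<open>2 ^ (Q ^ M - 2)\<close>.

  The sign pattern must be realised in degree \<open>D - 1\<close>. The variables form two sides. Subcubes with
  directions on one side have a fixed base on the other, and directions and bases are words over a
  constant-weight code of \<open>Q\<close> sets with pairwise small intersections, traversed in the order of a
  \<open>Q\<close>-ary Gray code. A base shows the word of its subcube up to one block, so few linear factors
  counting agreements vanish on all subcubes that share a given set of directions; multiplied with a
  monomial they give a triangular system, by which the values at all points of the subcubes except one
  corner each can be prescribed. A code with \<open>Q \<ge> 2 ^ (4 / 5 * q)\<close> words on \<open>q\<close> elements makes \<open>Q ^ M\<close> at
  least a constant times \<open>2 ^ (2 * n / 5)\<close> on \<open>n = 2 * q * M + const\<close> variables.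
\<close>

subsection \<open>Polynomial functions on subsets\<close>

text \<open>A point of the cube is identified with the set of its ones, so
  \<open>of_bool (S \<subseteq> X)\<close> is a squarefree monomial. The inductive form reduces
  statements linear in the polynomial to a single monomial.\<close>

inductive polyfn :: "'a set \<Rightarrow> nat \<Rightarrow> ('a set \<Rightarrow> int) \<Rightarrow> bool" for V d where
  monom: "S \<subseteq> V \<Longrightarrow> finite S \<Longrightarrow> card S \<le> d \<Longrightarrow> polyfn V d (\<lambda>X. k * of_bool (S \<subseteq> X))"
| add: "polyfn V d f \<Longrightarrow> polyfn V d g \<Longrightarrow> polyfn V d (\<lambda>X. f X + g X)"

lemma polyfn_const: "polyfn V d (\<lambda>X. k)"
  using polyfn.monom[of "{}" V d k] by simp

lemma polyfn_subset: "S \<subseteq> V \<Longrightarrow> finite S \<Longrightarrow> card S \<le> d \<Longrightarrow> polyfn V d (\<lambda>X. of_bool (S \<subseteq> X))"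
  using polyfn.monom[of S V d 1] by simp

lemma polyfn_member: "z \<in> V \<Longrightarrow> 0 < d \<Longrightarrow> polyfn V d (\<lambda>X. of_bool (z \<in> X))"
  using polyfn_subset[of "{z}" V d] by simp

lemma polyfn_mono: "polyfn V d f \<Longrightarrow> d \<le> e \<Longrightarrow> polyfn V e f"
  by (induction rule: polyfn.induct) (auto intro: polyfn.intros)

lemma polyfn_cmult: "polyfn V d f \<Longrightarrow> polyfn V d (\<lambda>X. c * f X)"
proof (induction rule: polyfn.induct)
  case (monom S k)
  then show ?case using polyfn.monom[of S V d "c * k"] by (simp add: mult.assoc)
next
  case (add f g)
  then show ?case using polyfn.add by (fastforce simp: distrib_left)
qed

lemma polyfn_diff: "polyfn V d f \<Longrightarrow> polyfn V d g \<Longrightarrow> polyfn V d (\<lambda>X. f X - g X)"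
  using polyfn.add[of V d f "\<lambda>X. (- 1) * g X"] polyfn_cmult[of V d g "- 1"] by simp

lemma polyfn_mult:
  assumes "polyfn V d f" "polyfn V e g"
  shows "polyfn V (d + e) (\<lambda>X. f X * g X)"
  using assms(1)
proof (induction rule: polyfn.induct)
  case (monom S k)
  show ?case
    using assms(2)
  proof (induction rule: polyfn.induct)
    case (monom T l)
    have "card (S \<union> T) \<le> d + e"
      using \<open>card S \<le> d\<close> \<open>card T \<le> e\<close> card_Un_le[of S T] by linarith
    then have "polyfn V (d + e) (\<lambda>X. (k * l) * of_bool (S \<union> T \<subseteq> X))"
      using \<open>S \<subseteq> V\<close> \<open>finite S\<close> monom by (intro polyfn.monom) auto
    moreover have "(\<lambda>X. (k * l) * of_bool (S \<union> T \<subseteq> X))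
        = (\<lambda>X. k * of_bool (S \<subseteq> X) * (l * of_bool (T \<subseteq> X)) :: int)"
      by (auto simp: fun_eq_iff)
    ultimately show ?case by simp
  next
    case (add f g)
    then show ?case using polyfn.add by (fastforce simp: distrib_left)
  qed
next
  case (add f1 f2)
  then show ?case using polyfn.add by (fastforce simp: distrib_right)
qed

lemma polyfn_sum:
  "finite I \<Longrightarrow> (\<And>i. i \<in> I \<Longrightarrow> polyfn V d (f i)) \<Longrightarrow> polyfn V d (\<lambda>X. \<Sum>i\<in>I. f i X)"
  by (induction rule: finite_induct) (auto intro: polyfn_const polyfn.add)

lemma polyfn_prod_linear:
  "(\<And>m. m < k \<Longrightarrow> polyfn V 1 (f m)) \<Longrightarrow> polyfn V k (\<lambda>X. \<Prod>m<k. f m X)"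
proof (induction k)
  case 0
  show ?case using polyfn_const[of V 0 1] by simp
next
  case (Suc k)
  have "polyfn V (k + 1) (\<lambda>X. (\<Prod>m<k. f m X) * f k X)"
    using Suc by (intro polyfn_mult) auto
  then show ?case by simp
qed

lemma polyfn_card_Int:
  assumes "finite Z" "Z \<subseteq> V"
  shows "polyfn V 1 (\<lambda>X. int (card (X \<inter> Z)))"
proof -
  have "polyfn V 1 (\<lambda>X. \<Sum>z\<in>Z. of_bool (z \<in> X))"
    using assms by (intro polyfn_sum polyfn_member) auto
  moreover have "(\<Sum>z\<in>Z. of_bool (z \<in> X)) = int (card (X \<inter> Z))" for X
    using assms(1) by (simp add: Int_commute)
  ultimately show ?thesis by simp
qed

section \<open>Alternating sums over subcubes and triangular systems\<close>

lemma alternating_sum_zero: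
  fixes f :: "'a set \<Rightarrow> int"
  assumes "finite F" "z \<in> F" "\<And>S. S \<subseteq> F - {z} \<Longrightarrow> f (insert z S) = f S"
  shows "(\<Sum>S\<in>Pow F. (- 1) ^ card S * f S) = 0"
proof -
  define E where "E = F - {z}"
  have E: "F = insert z E" "z \<notin> E" "finite E"
    using assms by (auto simp: E_def)
  have "(\<Sum>S\<in>Pow F. (- 1) ^ card S * f S)
      = (\<Sum>S\<in>Pow E. (- 1) ^ card S * f S) + (\<Sum>S\<in>insert z ` Pow E. (- 1) ^ card S * f S)"
    unfolding E(1) Pow_insert using E by (intro sum.union_disjoint) auto
  also have "(\<Sum>S\<in>insert z ` Pow E. (- 1) ^ card S * f S)
      = (\<Sum>S\<in>Pow E. (- 1) ^ card (insert z S) * f (insert z S))"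
    using E(2) by (subst sum.reindex) (auto simp: inj_on_def)
  also have "\<dots> = (\<Sum>S\<in>Pow E. - ((- 1) ^ card S * f S))"
  proof (rule sum.cong[OF refl])
    fix S assume S: "S \<in> Pow E"
    then have "finite S" "z \<notin> S" using E finite_subset by auto
    then show "(- 1) ^ card (insert z S) * f (insert z S) = - ((- 1) ^ card S * f S)"
      using assms(3)[of S] S by (simp add: E_def)
  qed
  finally show ?thesis by (simp add: sum_negf)
qed

text \<open>A monomial in at most \<open>d\<close> variables misses some direction of
  \<open>F\<close>. Switching that direction flips the sign but not the monomial, so the terms
  cancel in pairs.\<close>

lemma polyfn_alternating_sum:
  assumes "polyfn V d f" "finite F" "d < card F"
  shows "(\<Sum>S\<in>Pow F. (- 1) ^ card S * f (R \<union> S)) = 0"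
  using assms(1)
proof (induction rule: polyfn.induct)
  case (monom T k)
  then have "\<not> F \<subseteq> T"
    using assms card_mono[of T F] by auto
  then obtain z where "z \<in> F" "z \<notin> T" by auto
  then show ?case
    using assms(2) by (intro alternating_sum_zero[of F z]) auto
next
  case (add f g)
  then show ?case by (simp add: distrib_left sum.distrib)
qed

text \<open>Points are added by increasing rank. The polynomial of the new point vanishes at all
  earlier ones, so a multiple of it corrects the new value alone. Division by \<open>q u\<close> is
  impossible over the integers, hence the common factor \<open>k\<close>; being positive, it
  preserves all signs.\<close>

lemma triangular_interpolation:
  fixes rank :: "'a set \<Rightarrow> nat"
  assumes "finite U"
    and "\<And>u. u \<in> U \<Longrightarrow> \<exists>q. polyfn V d q \<and> q u \<noteq> 0 \<and> (\<forall>u'\<in>U. u' \<noteq> u \<longrightarrow> rank u' \<le> rank u \<longrightarrow> q u' = 0)"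
  shows "\<exists>k p. k > 0 \<and> polyfn V d p \<and> (\<forall>u\<in>U. p u = k * t u)"
  using assms
proof (induction U rule: finite_ranking_induct[where f = rank])
  case empty
  show ?case using polyfn_const[of V d 0] by (intro exI[of _ 1] exI[of _ "\<lambda>_. 0"]) auto
next
  case (insert u U)
  have "\<exists>k p. k > 0 \<and> polyfn V d p \<and> (\<forall>u\<in>U. p u = k * t u)"
  proof (rule insert.IH)
    fix v assume "v \<in> U"
    with insert.prems[of v] show "\<exists>q. polyfn V d q \<and> q v \<noteq> 0 \<and>
        (\<forall>u'\<in>U. u' \<noteq> v \<longrightarrow> rank u' \<le> rank v \<longrightarrow> q u' = 0)"
      by (metis insertI2)
  qed
  then obtain k p where p: "k > 0" "polyfn V d p" "\<And>u. u \<in> U \<Longrightarrow> p u = k * t u"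
    by auto
  show ?case
  proof (cases "u \<in> U")
    case True
    then show ?thesis using p by (metis insert_absorb)
  next
    case False
    obtain q where q: "polyfn V d q" "q u \<noteq> 0"
      "\<And>u'. u' \<in> insert u U \<Longrightarrow> u' \<noteq> u \<Longrightarrow> rank u' \<le> rank u \<Longrightarrow> q u' = 0"
      using insert.prems[of u] by auto
    \<comment> \<open>Scaling by \<open>\<bar>q u\<bar>\<close> instead of \<open>q u\<close> keeps
      the common factor positive; \<open>sgn (q u)\<close> compensates in the correction
      term.\<close>
    define p' where "p' = (\<lambda>X. \<bar>q u\<bar> * p X + (sgn (q u) * (k * t u - p u)) * q X)"
    have "polyfn V d p'"
      unfolding p'_def by (intro polyfn.add polyfn_cmult p q)
    moreover have "p' u' = (\<bar>q u\<bar> * k) * t u'" if "u' \<in> insert u U" for u'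
    proof (cases "u' = u")
      case True
      have "p' u = \<bar>q u\<bar> * p u + (sgn (q u) * q u) * (k * t u - p u)"
        by (simp add: p'_def algebra_simps)
      also have "sgn (q u) * q u = \<bar>q u\<bar>" by (simp add: abs_sgn mult.commute)
      finally show ?thesis using True by (simp add: algebra_simps)
    next
      case False
      then show ?thesis
        using that p(3)[of u'] q(3)[of u'] insert.hyps by (auto simp: p'_def)
    qed
    ultimately show ?thesis
      using p(1) q(2) by (intro exI[of _ "\<bar>q u\<bar> * k"] exI[of _ p']) auto
  qed
qed

subsection \<open>Interpolation on two crossing families of cubes\<close>

text \<open>Strict inclusion omits the top corner \<open>b k \<union> F k\<close>: in degree below
  the dimension of the cube, its value is forced by the alternating sum.\<close>

definition proper_points :: "'k set \<Rightarrow> ('k \<Rightarrow> 'a set) \<Rightarrow> ('k \<Rightarrow> 'a set) \<Rightarrow> 'a set set" where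
  "proper_points K F b = {b k \<union> S | k S. k \<in> K \<and> S \<subset> F k}"

lemma proper_pointsI: "k \<in> K \<Longrightarrow> S \<subset> F k \<Longrightarrow> b k \<union> S \<in> proper_points K F b"
  unfolding proper_points_def by blast

text \<open>The monomial of \<open>S\<close> times \<open>g\<close> has degree \<open>D - 2\<close>
  when \<open>S\<close> misses at least two of \<open>D\<close> directions; the one degree left up
  to \<open>D - 1\<close> pays for vanishing on the other family. Since \<open>g\<close> reads only
  \<open>B\<close>, it is constant on a cube whose directions avoid \<open>B\<close>.\<close>

definition separated :: "'a set \<Rightarrow> 'a set \<Rightarrow> nat \<Rightarrow> 'k set \<Rightarrow> ('k \<Rightarrow> 'a set) \<Rightarrow> ('k \<Rightarrow> 'a set) \<Rightarrow> bool" where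
  "separated V B D K F b \<longleftrightarrow> (\<forall>k\<in>K. \<forall>S. S \<subset> F k \<longrightarrow>
     (\<exists>g. polyfn V (D - 2 - card S) g \<and> (\<forall>X. g X = g (X \<inter> B)) \<and> g (b k) \<noteq> 0 \<and>
        (\<forall>k'\<in>K. S \<subseteq> F k' \<longrightarrow> b k' \<noteq> b k \<longrightarrow> g (b k') = 0)))"

text \<open>The first family has directions in \<open>A\<close> and bases in \<open>B\<close>, the
  second the reverse. By \<open>coverF\<close> and \<open>coverG\<close>, a base that fits into no
  cube over a given opposite base has one coordinate outside all of those cubes, so a single linear
  factor vanishes on them.\<close>

locale cube_families =
  fixes V A B :: "'a set" and D w :: nat
    and K :: "'k set" and F b :: "'k \<Rightarrow> 'a set"
    and J :: "'l set" and G a :: "'l \<Rightarrow> 'a set"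
  assumes finite_V: "finite V" and A_V: "A \<subseteq> V" and B_V: "B \<subseteq> V" and disj: "A \<inter> B = {}"
    and F_sub: "k \<in> K \<Longrightarrow> F k \<subseteq> A" and F_card: "k \<in> K \<Longrightarrow> card (F k) = D"
    and b_sub: "k \<in> K \<Longrightarrow> b k \<subseteq> B" and b_card: "k \<in> K \<Longrightarrow> card (b k) = w"
    and G_sub: "l \<in> J \<Longrightarrow> G l \<subseteq> B" and G_card: "l \<in> J \<Longrightarrow> card (G l) = D"
    and a_sub: "l \<in> J \<Longrightarrow> a l \<subseteq> A" and a_card: "l \<in> J \<Longrightarrow> card (a l) = w"
    and w_le: "w + 2 \<le> D"
    and sepF: "separated V B D K F b" and sepG: "separated V A D J G a"
    and coverF: "k \<in> K \<Longrightarrow> l \<in> J \<Longrightarrow> (\<And>k'. k' \<in> K \<Longrightarrow> b k' = b k \<Longrightarrow> \<not> a l \<subseteq> F k')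
        \<Longrightarrow> \<exists>z\<in>a l. \<forall>k'\<in>K. b k' = b k \<longrightarrow> z \<notin> F k'"
    and coverG: "l \<in> J \<Longrightarrow> k \<in> K \<Longrightarrow> (\<And>l'. l' \<in> J \<Longrightarrow> a l' = a l \<Longrightarrow> \<not> b k \<subseteq> G l')
        \<Longrightarrow> \<exists>z\<in>b k. \<forall>l'\<in>J. a l' = a l \<longrightarrow> z \<notin> G l'"
begin

text \<open>Lets \<open>interpolation\<close> apply \<open>own_point_poly\<close> to the second
  family as well.\<close>

lemma swap: "cube_families V B A D w J G a K F b"
  by (rule cube_families.intro)
    (simp_all add: finite_V A_V B_V disj Int_commute F_sub F_card b_sub b_card G_sub G_card a_sub
      a_card w_le[simplified] sepF sepG coverF coverG)

lemma pointF:
  assumes "k \<in> K" "S \<subseteq> F k"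
  shows "(b k \<union> S) \<inter> A = S" "(b k \<union> S) \<inter> B = b k" "card (b k \<union> S) = w + card S" "finite S"
proof -
  show "(b k \<union> S) \<inter> A = S" "(b k \<union> S) \<inter> B = b k"
    using assms F_sub[of k] b_sub[of k] disj by blast+
  have fin: "finite (F k)" "finite (b k)"
    using assms F_sub[of k] b_sub[of k] A_V B_V finite_V by (meson finite_subset)+
  then show "finite S" using assms finite_subset by auto
  moreover have "b k \<inter> S = {}" using assms F_sub[of k] b_sub[of k] disj by blast
  ultimately show "card (b k \<union> S) = w + card S"
    using fin b_card[OF assms(1)] by (simp add: card_Un_disjoint)
qed

lemma pointG:
  assumes "l \<in> J" "T \<subseteq> G l"
  shows "(a l \<union> T) \<inter> A = a l" "(a l \<union> T) \<inter> B = T"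
  using assms G_sub[of l] a_sub[of l] disj by blast+

lemma separatorF:
  assumes "k \<in> K" "S \<subset> F k"
  obtains g where "polyfn V (D - 2 - card S) g" "g (b k \<union> S) \<noteq> 0"
    "\<And>k' S'. k' \<in> K \<Longrightarrow> S' \<subseteq> F k' \<Longrightarrow> S \<subseteq> S' \<Longrightarrow> b k' \<noteq> b k \<Longrightarrow> g (b k' \<union> S') = 0"
proof -
  obtain g where g: "polyfn V (D - 2 - card S) g" "\<forall>X. g X = g (X \<inter> B)" "g (b k) \<noteq> 0"
    "\<forall>k'\<in>K. S \<subseteq> F k' \<longrightarrow> b k' \<noteq> b k \<longrightarrow> g (b k') = 0"
    using sepF[unfolded separated_def, rule_format, OF assms] by (elim exE conjE)
  have g_base: "g (b k' \<union> S') = g (b k')" if "k' \<in> K" "S' \<subseteq> F k'" for k' S'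
    using g(2)[rule_format, of "b k' \<union> S'"] pointF(2)[OF that] by metis
  show thesis
  proof (rule that[of g])
    show "g (b k \<union> S) \<noteq> 0"
      using g_base[of k S] g(3) assms by auto
    show "g (b k' \<union> S') = 0" if "k' \<in> K" "S' \<subseteq> F k'" "S \<subseteq> S'" "b k' \<noteq> b k" for k' S'
      using g_base[of k' S'] g(4) that by auto
  qed (fact g)
qed

lemma subset_point_iff:
  assumes "k \<in> K" "S \<subseteq> F k" "k' \<in> K" "S' \<subseteq> F k'"
  shows "S \<subseteq> b k' \<union> S' \<longleftrightarrow> S \<subseteq> S'"
  using assms F_sub[of k] b_sub[of k'] disj by blast

lemma subset_pointG_iff:
  assumes "k \<in> K" "S \<subseteq> F k" "l \<in> J" "T \<subseteq> G l"
  shows "S \<subseteq> a l \<union> T \<longleftrightarrow> S \<subseteq> a l"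
  using assms F_sub[of k] G_sub[of l] disj by blast

lemma S_props:
  assumes "k \<in> K" "S \<subset> F k"
  shows "S \<subseteq> V" "finite S" "card S < D"
proof -
  show "S \<subseteq> V" using assms F_sub A_V by blast
  then show "finite S" using finite_V finite_subset by auto
  have "finite (F k)" using assms F_sub[of k] A_V finite_V by (meson finite_subset)
  then show "card S < D" using psubset_card_mono[of "F k" S] assms F_card by auto
qed

text \<open>The \<open>A\<close>-part of a common point is the direction set \<open>S\<close> in one
  cube and the base in the other, so it always has size \<open>w\<close>. Hence the monomial of
  \<open>S\<close> keeps only common points with \<open>A\<close>-part exactly \<open>S\<close>, and
  the separator fixes the \<open>B\<close>-part.\<close>

lemma common_point_poly:
  assumes u: "u \<in> proper_points K F b" "u \<in> proper_points J G a"
  shows "\<exists>q. polyfn V (D - 1) q \<and> q u \<noteq> 0 \<and>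
    (\<forall>u'\<in>proper_points K F b \<inter> proper_points J G a. u' \<noteq> u \<longrightarrow> q u' = 0)"
proof -
  obtain k S where k: "k \<in> K" "S \<subset> F k" "u = b k \<union> S"
    using u(1) unfolding proper_points_def by blast
  obtain l T where l: "l \<in> J" "T \<subset> G l" "u = a l \<union> T"
    using u(2) unfolding proper_points_def by blast
  have S: "S = a l"
    using pointF(1)[of k S] pointG(1)[of l T] k l by auto
  note Sp = S_props[OF k(1,2)]
  obtain g where g: "polyfn V (D - 2 - card S) g" "g (b k \<union> S) \<noteq> 0"
    "\<And>k' S'. k' \<in> K \<Longrightarrow> S' \<subseteq> F k' \<Longrightarrow> S \<subseteq> S' \<Longrightarrow> b k' \<noteq> b k \<Longrightarrow> g (b k' \<union> S') = 0"
    using separatorF[OF k(1,2)] by blast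
  define q where "q = (\<lambda>X. of_bool (S \<subseteq> X) * g X)"
  have "polyfn V (card S + (D - 2 - card S)) q"
    unfolding q_def using Sp by (intro polyfn_mult polyfn_subset g) auto
  then have "polyfn V (D - 1) q"
    by (rule polyfn_mono) (use Sp(3) in linarith)
  moreover have "q u \<noteq> 0" using g(2) k by (simp add: q_def)
  moreover have "q u' = 0"
    if u': "u' \<in> proper_points K F b" "u' \<in> proper_points J G a" "u' \<noteq> u" for u'
  proof (rule ccontr)
    assume nz: "q u' \<noteq> 0"
    obtain k' S' where k': "k' \<in> K" "S' \<subset> F k'" "u' = b k' \<union> S'"
      using u'(1) unfolding proper_points_def by blast
    obtain l' T' where l': "l' \<in> J" "T' \<subset> G l'" "u' = a l' \<union> T'"
      using u'(2) unfolding proper_points_def by blast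
    have S': "S' = a l'"
      using pointF(1)[of k' S'] pointG(1)[of l' T'] k' l' by auto
    have "S \<subseteq> S'"
      using nz subset_point_iff[of k S k' S'] k k' by (auto simp: q_def split: if_splits)
    moreover have "card S = card S'" "finite S'"
      using S S' a_card[OF l(1)] a_card[OF l'(1)] pointF(4)[of k' S'] k' by auto
    ultimately have "S = S'" by (metis card_subset_eq)
    moreover have "b k' = b k"
      using nz g(3)[of k' S'] \<open>S = S'\<close> k' by (auto simp: q_def)
    ultimately show False using u'(3) k k' by simp
  qed
  ultimately show ?thesis by blast
qed

text \<open>In the own family, the monomial of \<open>S\<close> and the separator leave only points
  over \<open>b k\<close> that contain \<open>u\<close>, and these are larger. A third factor
  \<open>h\<close> removes the other family within the remaining degree.\<close>

lemma own_point_poly: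
  assumes u: "u \<in> proper_points K F b" "u \<notin> proper_points J G a"
  shows "\<exists>q. polyfn V (D - 1) q \<and> q u \<noteq> 0 \<and> (\<forall>u'\<in>proper_points J G a. q u' = 0) \<and>
    (\<forall>u'\<in>proper_points K F b. u' \<noteq> u \<longrightarrow> card u' \<le> card u \<longrightarrow> q u' = 0)"
proof -
  obtain k S where k: "k \<in> K" "S \<subset> F k" "u = b k \<union> S"
    using u(1) unfolding proper_points_def by blast
  note Sp = S_props[OF k(1,2)]
  obtain g where g: "polyfn V (D - 2 - card S) g" "g (b k \<union> S) \<noteq> 0"
    "\<And>k' S'. k' \<in> K \<Longrightarrow> S' \<subseteq> F k' \<Longrightarrow> S \<subseteq> S' \<Longrightarrow> b k' \<noteq> b k \<Longrightarrow> g (b k' \<union> S') = 0"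
    using separatorF[OF k(1,2)] by blast
  \<comment> \<open>The degree left for \<open>h\<close> is \<open>1\<close>, or \<open>0\<close> if
    \<open>card S = D - 1\<close>. In the latter case \<open>S\<close> has more than
    \<open>w\<close> elements and lies in no \<open>a l\<close>, so \<open>h = 1\<close>
    suffices.\<close>
  have "\<exists>h. polyfn V (D - 1 - card S - (D - 2 - card S)) h \<and> h u \<noteq> 0 \<and>
      (\<forall>l\<in>J. \<forall>T. T \<subset> G l \<longrightarrow> S \<subseteq> a l \<longrightarrow> h (a l \<union> T) = 0)"
  proof (cases "\<exists>l\<in>J. S \<subseteq> a l")
    case False
    then show ?thesis
      by (intro exI[of _ "\<lambda>_. 1"]) (auto intro: polyfn_const)
  next
    case True
    then obtain l where l: "l \<in> J" "S \<subseteq> a l" by auto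
    have fin: "finite (a l')" if "l' \<in> J" for l'
      using that a_sub[of l'] A_V finite_V by (meson finite_subset)
    have Sw: "card S \<le> w" using l a_card[of l] fin card_mono by metis
    then have deg: "D - 1 - card S - (D - 2 - card S) = 1" using w_le by linarith
    show ?thesis
    proof (cases "card S = w")
      case False
      \<comment> \<open>Points of the second family have exactly \<open>w\<close> elements in
        \<open>A\<close>, whereas \<open>u\<close> has \<open>card S\<close>.\<close>
      have "polyfn V 1 (\<lambda>X. int (card (X \<inter> A)) - int w)"
        using A_V finite_V finite_subset by (intro polyfn_diff polyfn_card_Int polyfn_const) auto
      moreover have "int (card (u \<inter> A)) - int w \<noteq> 0"
        using False k pointF(1)[of k S] by auto
      moreover have "int (card ((a l' \<union> T) \<inter> A)) - int w = 0" if "l' \<in> J" "T \<subset> G l'" for l' T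
        using that pointG(1)[of l' T] a_card[of l'] by auto
      ultimately show ?thesis unfolding deg by blast
    next
      case True
      have eq: "a l' = S" if "l' \<in> J" "S \<subseteq> a l'" for l'
        using that True a_card[of l'] fin[of l'] by (metis card_subset_eq)
      \<comment> \<open>Here \<open>S\<close> is itself the base \<open>a l\<close>. If
        \<open>b k\<close> fitted into a cube over it, strictly because of its size,
        \<open>u\<close> would be a proper point of the second family.\<close>
      have nb: "\<not> b k \<subseteq> G l'" if "l' \<in> J" "a l' = a l" for l'
      proof
        assume sub: "b k \<subseteq> G l'"
        have "card (b k) \<noteq> card (G l')" using k that b_card[of k] G_card[of l'] w_le by auto
        then have "b k \<subset> G l'" using sub by auto
        moreover have "u = a l' \<union> b k" using k that eq[of l] l by auto
        ultimately show False using u(2) that(1) unfolding proper_points_def by blast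
      qed
      obtain z where z: "z \<in> b k" "\<And>l'. l' \<in> J \<Longrightarrow> a l' = a l \<Longrightarrow> z \<notin> G l'"
        using coverG[OF l(1) k(1) nb] by blast
      have zB: "z \<in> B" using z(1) b_sub[of k] k by auto
      then have "polyfn V 1 (\<lambda>X. of_bool (z \<in> X))"
        using B_V by (intro polyfn_member) auto
      moreover have "of_bool (z \<in> u) \<noteq> (0::int)" using z k by simp
      moreover have "of_bool (z \<in> a l' \<union> T) = (0::int)"
        if "l' \<in> J" "T \<subset> G l'" "S \<subseteq> a l'" for l' T
        using that eq[OF that(1,3)] eq[OF l] z(2)[of l'] zB a_sub[of l'] disj by auto
      ultimately show ?thesis unfolding deg by blast
    qed
  qed
  then obtain h where h: "polyfn V (D - 1 - card S - (D - 2 - card S)) h" "h u \<noteq> 0"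
      "\<forall>l\<in>J. \<forall>T. T \<subset> G l \<longrightarrow> S \<subseteq> a l \<longrightarrow> h (a l \<union> T) = 0"
    by (elim exE conjE)
  define q where "q = (\<lambda>X. of_bool (S \<subseteq> X) * g X * h X)"
  have "polyfn V (card S + (D - 2 - card S) + (D - 1 - card S - (D - 2 - card S))) q"
    unfolding q_def using Sp by (intro polyfn_mult polyfn_subset g h) auto
  then have "polyfn V (D - 1) q"
    by (rule polyfn_mono) (use Sp(3) in linarith)
  moreover have "q u \<noteq> 0" using g(2) h(2) k by (simp add: q_def)
  moreover have "q u' = 0" if u': "u' \<in> proper_points J G a" for u'
  proof -
    obtain l T where l: "l \<in> J" "T \<subset> G l" "u' = a l \<union> T"
      using u' unfolding proper_points_def by blast
    show ?thesis
      using h(3) subset_pointG_iff[of k S l T] k l by (auto simp: q_def)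
  qed
  moreover have "q u' = 0" if u': "u' \<in> proper_points K F b" "u' \<noteq> u" "card u' \<le> card u" for u'
  proof (rule ccontr)
    assume nz: "q u' \<noteq> 0"
    obtain k' S' where k': "k' \<in> K" "S' \<subset> F k'" "u' = b k' \<union> S'"
      using u'(1) unfolding proper_points_def by blast
    have sub: "S \<subseteq> S'"
      using nz subset_point_iff[of k S k' S'] k k' by (auto simp: q_def split: if_splits)
    moreover have "b k' = b k"
      using nz g(3)[of k' S'] sub k' by (auto simp: q_def)
    moreover have "card S' \<le> card S"
      using u'(3) pointF(3)[of k S] pointF(3)[of k' S'] k k' by auto
    then have "S = S'"
      using sub pointF(4)[of k' S'] k' by (metis card_seteq psubset_imp_subset)
    ultimately show False using u'(2) k k' by simp
  qed
  ultimately show ?thesis by blast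
qed

text \<open>Points common to both families are treated first, the others by increasing size.\<close>

lemma interpolation:
  "\<exists>k p. k > 0 \<and> polyfn V (D - 1) p \<and>
     (\<forall>u\<in>proper_points K F b \<union> proper_points J G a. p u = k * t u)"
proof -
  interpret sw: cube_families V B A D w J G a K F b by (rule swap)
  let ?P = "proper_points K F b" and ?N = "proper_points J G a"
  define rank where "rank = (\<lambda>u. if u \<in> ?P \<inter> ?N then 0 else Suc (card u))"
  show ?thesis
  proof (rule triangular_interpolation[where rank = rank])
    have "b k \<union> S \<subseteq> V" if "k \<in> K" "S \<subset> F k" for k S
      using that F_sub[of k] b_sub[of k] A_V B_V by auto
    moreover have "a l \<union> S \<subseteq> V" if "l \<in> J" "S \<subset> G l" for l S
      using that G_sub[of l] a_sub[of l] A_V B_V by auto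
    ultimately have "u \<in> Pow V" if "u \<in> ?P \<union> ?N" for u
      using that unfolding proper_points_def by (elim UnE CollectE exE conjE) simp_all
    then have "?P \<union> ?N \<subseteq> Pow V" by (rule subsetI)
    then show "finite (?P \<union> ?N)" using finite_V finite_subset by (metis finite_Pow_iff)
  next
    fix u assume u: "u \<in> ?P \<union> ?N"
    show "\<exists>q. polyfn V (D - 1) q \<and> q u \<noteq> 0 \<and>
        (\<forall>u'\<in>?P \<union> ?N. u' \<noteq> u \<longrightarrow> rank u' \<le> rank u \<longrightarrow> q u' = 0)"
    proof (cases "u \<in> ?P \<and> u \<in> ?N")
      case True
      then obtain q where "polyfn V (D - 1) q" "q u \<noteq> 0"
        "\<forall>u'\<in>?P \<inter> ?N. u' \<noteq> u \<longrightarrow> q u' = 0"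
        using common_point_poly[of u] by auto
      then show ?thesis
        using True by (intro exI[of _ q]) (auto simp: rank_def split: if_splits)
    next
      case False
      then have "(\<exists>q. polyfn V (D - 1) q \<and> q u \<noteq> 0 \<and> (\<forall>u'\<in>?N. q u' = 0) \<and>
            (\<forall>u'\<in>?P. u' \<noteq> u \<longrightarrow> card u' \<le> card u \<longrightarrow> q u' = 0)) \<or>
          (\<exists>q. polyfn V (D - 1) q \<and> q u \<noteq> 0 \<and> (\<forall>u'\<in>?P. q u' = 0) \<and>
            (\<forall>u'\<in>?N. u' \<noteq> u \<longrightarrow> card u' \<le> card u \<longrightarrow> q u' = 0))"
        using own_point_poly[of u] sw.own_point_poly[of u] u by (elim UnE) simp_all
      then obtain q where q: "polyfn V (D - 1) q" "q u \<noteq> 0"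
        "\<And>u'. u' \<in> ?P \<union> ?N \<Longrightarrow> u' \<noteq> u \<Longrightarrow> u' \<in> ?P \<inter> ?N \<or> card u' \<le> card u \<Longrightarrow> q u' = 0"
        by (elim disjE exE conjE) (metis IntD1 IntD2 UnE)+
      show ?thesis
      proof (intro exI[of _ q] conjI ballI impI)
        fix u' assume "u' \<in> ?P \<union> ?N" "u' \<noteq> u" "rank u' \<le> rank u"
        then show "q u' = 0"
          using False q(3)[of u'] unfolding rank_def by (cases "u' \<in> ?P \<inter> ?N") auto
      qed (fact q)+
    qed
  qed
qed

end

subsection \<open>Growth along a ladder of cubes\<close>

text \<open>The sign comes from the size of the whole point, not of \<open>S\<close>, so that a
  point lying on several cubes carries the same sign in each.\<close>

lemma signed_cube_sum:
  assumes "polyfn V d p" "finite F" "d < card F" "finite R" "R \<inter> F = {}"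
  shows "(\<Sum>S\<in>Pow F. (- 1) ^ card (R \<union> S) * p (R \<union> S)) = 0"
proof -
  have "(\<Sum>S\<in>Pow F. (- 1) ^ card (R \<union> S) * p (R \<union> S))
      = (\<Sum>S\<in>Pow F. (- 1) ^ card R * ((- 1) ^ card S * p (R \<union> S)))"
  proof (rule sum.cong[OF refl])
    fix S assume S: "S \<in> Pow F"
    then have "card (R \<union> S) = card R + card S"
      using assms by (intro card_Un_disjoint) (auto intro: finite_subset)
    then show "(- 1) ^ card (R \<union> S) * p (R \<union> S) = (- 1) ^ card R * ((- 1) ^ card S * p (R \<union> S))"
      by (simp add: power_add)
  qed
  then show ?thesis
    using polyfn_alternating_sum[OF assms(1-3), of R] by (simp flip: sum_distrib_left)
qed

text \<open>Solving for \<open>v F\<close> gives \<open>m\<close> minus fewer than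
  \<open>2 ^ card F\<close> terms, each at most \<open>m'\<close>. This yields the sign at the top
  corner, which interpolation does not prescribe.\<close>

lemma cube_top_positive:
  fixes v :: "'a set \<Rightarrow> int"
  assumes "finite F" "E \<subset> F" "(\<Sum>S\<in>Pow F. v S) = 0" "v E = - m"
    and le: "\<And>S. S \<subset> F \<Longrightarrow> S \<noteq> E \<Longrightarrow> v S \<le> m'" and "0 < m'" "2 ^ card F * m' \<le> m"
  shows "0 < v F"
proof -
  let ?R = "Pow F - {E} - {F}"
  have "(\<Sum>S\<in>Pow F. v S) = v E + (v F + (\<Sum>S\<in>?R. v S))"
    using assms(1,2) by (subst sum.remove[of _ E], simp, simp add: psubset_imp_subset)
      (subst sum.remove[of _ F], auto)
  moreover have "(\<Sum>S\<in>?R. v S) \<le> of_nat (card ?R) * m'"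
    by (rule sum_bounded_above) (use le in auto)
  moreover have "card ?R = 2 ^ card F - 2"
    using assms(1,2) by (subst card_Diff_singleton; auto simp: card_Pow)
  then have "card ?R < 2 ^ card F"
    by (metis diff_less zero_less_numeral zero_less_power)
  then have "int (card ?R) < 2 ^ card F"
    by (metis of_nat_less_iff of_nat_numeral of_nat_power)
  then have "of_nat (card ?R) * m' < 2 ^ card F * m'"
    using \<open>0 < m'\<close> by (intro mult_strict_right_mono) auto
  ultimately show ?thesis using assms(3,4,7) by linarith
qed

text \<open>Nonnegativity away from \<open>E\<close> excludes cancellation, so \<open>- v E\<close>
  is the sum of all other absolute values.\<close>

lemma cube_growth:
  fixes v :: "'a set \<Rightarrow> int"
  assumes "finite F" "E \<in> Pow F" "(\<Sum>S\<in>Pow F. v S) = 0"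
    and nonneg: "\<And>S. S \<subseteq> F \<Longrightarrow> S \<noteq> E \<Longrightarrow> 0 \<le> v S"
    and "X \<subseteq> Pow F - {E}"
  shows "(\<Sum>S\<in>X. \<bar>v S\<bar>) \<le> \<bar>v E\<bar>"
proof -
  have "(\<Sum>S\<in>X. \<bar>v S\<bar>) = (\<Sum>S\<in>X. v S)"
    using assms(5) by (intro sum.cong refl abs_of_nonneg nonneg) auto
  also have "\<dots> \<le> (\<Sum>S\<in>Pow F - {E}. v S)"
    using assms nonneg by (intro sum_mono2) auto
  also have "\<dots> = - v E"
    using sum.remove[of "Pow F" E v] assms by simp
  finally show ?thesis by simp
qed

text \<open>The cube \<open>F (i, e)\<close> at \<open>b i\<close> contains \<open>a (i, False)\<close> and \<open>a (i, True)\<close> and has the exceptional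
  point \<open>a (Suc i, e)\<close>; the cube \<open>G (j, e)\<close> at \<open>a (j, e)\<close> contains \<open>b (j - 1)\<close> and has the exceptional
  point \<open>b j\<close>. Having both \<open>e\<close> is what doubles the values.\<close>

locale ladder = cube_families V A B D w "{..<L} \<times> UNIV" F "\<lambda>k. b (fst k)" "{1..<L} \<times> UNIV" G a
  for V A B :: "'a set" and D w L :: nat
    and F G a :: "nat \<times> bool \<Rightarrow> 'a set" and b :: "nat \<Rightarrow> 'a set" +
  assumes w_ge: "2 \<le> w" and L_pos: "0 < L"
    and a_stay: "1 \<le> i \<Longrightarrow> i < L \<Longrightarrow> a (i, e') \<subset> F (i, e)"
    and a_next: "i < L \<Longrightarrow> a (Suc i, e) \<subset> F (i, e)"
    and a_other: "i < L \<Longrightarrow> \<not> a (Suc i, \<not> e) \<subseteq> F (i, e)"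
    and a_card': "1 \<le> i \<Longrightarrow> i \<le> L \<Longrightarrow> card (a (i, e)) = w"
    and b_prev: "Suc i < L \<Longrightarrow> b i \<subset> G (Suc i, e)"
    and b_stay: "1 \<le> i \<Longrightarrow> i < L \<Longrightarrow> b i \<subset> G (i, e)"
    and b_inj: "i < L \<Longrightarrow> j < L \<Longrightarrow> b i = b j \<Longrightarrow> i = j"
    and a_inj: "1 \<le> i \<Longrightarrow> i \<le> L \<Longrightarrow> 1 \<le> j \<Longrightarrow> j \<le> L \<Longrightarrow> a (i, e) = a (j, e') \<Longrightarrow> i = j \<and> e = e'"
    and cross: "i < L \<Longrightarrow> 1 \<le> j \<Longrightarrow> j < L \<Longrightarrow> a (j, e') \<subseteq> F (i, e) \<Longrightarrow> b i \<subseteq> G (j, e')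
        \<Longrightarrow> j = i \<or> (j = Suc i \<and> e' = e)"
begin

abbreviation "pos_points \<equiv> proper_points ({..<L} \<times> UNIV) F (\<lambda>k. b (fst k))"
abbreviation "neg_points \<equiv> proper_points ({1..<L} \<times> UNIV) G a"

definition row :: "'a set \<Rightarrow> nat" where
  "row X = (THE i. i < L \<and> X \<inter> B = b i)"

text \<open>Prescribed values with the parity sign removed. Along the ladder the exceptional values
  are, up to sign, consecutive powers of \<open>2 ^ D\<close>, the number of points of a cube, so
  each outweighs the rest of its cube. All other points only need a sign.\<close>

definition target :: "'a set \<Rightarrow> int" where
  "target X =
     (if \<exists>e. 1 \<le> row X \<and> row X < L \<and> X = b (row X) \<union> a (row X, e) then (2 ^ D) ^ (2 * row X)
      else if \<exists>e. row X < L \<and> X = b (row X) \<union> a (Suc (row X), e) then - ((2 ^ D) ^ (2 * row X + 1))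
      else if X \<in> pos_points then 1 else - 1)"

lemma a_sub': "1 \<le> i \<Longrightarrow> i \<le> L \<Longrightarrow> a (i, e) \<subseteq> A"
  using a_next[of "i - 1" e] F_sub[of "(i - 1, e)"] by (cases i) auto

lemma b_sub': "i < L \<Longrightarrow> b i \<subseteq> B"
  using b_sub[of "(i, True)"] by simp

lemma row_eq: "i < L \<Longrightarrow> X \<inter> B = b i \<Longrightarrow> row X = i"
  unfolding row_def using b_inj by (intro the_equality) auto

lemma union_eqD:
  assumes "S \<subseteq> A" "S' \<subseteq> A" "T \<subseteq> B" "T' \<subseteq> B" "T \<union> S = T' \<union> S'"
  shows "S = S'" "T = T'"
  using assms disj by blast+

lemma target_pos:
  assumes i: "i < L" and S: "S \<subset> F (i, e)"
  shows "S = a (Suc i, e) \<Longrightarrow> target (b i \<union> S) = - ((2 ^ D) ^ (2 * i + 1))"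
    and "S \<noteq> a (Suc i, e) \<Longrightarrow> 0 < target (b i \<union> S) \<and> target (b i \<union> S) \<le> (2 ^ D) ^ (2 * i)"
proof -
  have SA: "S \<subseteq> A" using S F_sub[of "(i, e)"] i by auto
  have "(b i \<union> S) \<inter> B = b i" using pointF(2)[of "(i, e)" S] S i by auto
  then have row: "row (b i \<union> S) = i" using row_eq i by blast
  have eq: "b i \<union> S = b i \<union> a (j, e') \<longleftrightarrow> S = a (j, e')" if "1 \<le> j" "j \<le> L" for j e'
    using union_eqD[OF SA a_sub'[OF that] b_sub'[OF i] b_sub'[OF i]] by blast
  show "target (b i \<union> S) = - ((2 ^ D) ^ (2 * i + 1))" if "S = a (Suc i, e)"
  proof -
    have "\<not> (1 \<le> i \<and> i < L \<and> b i \<union> S = b i \<union> a (i, e'))" for e'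
      using eq[of i e'] that a_inj[of "Suc i" i e e'] i by auto
    then show ?thesis unfolding target_def row using that i by auto
  qed
  show "0 < target (b i \<union> S) \<and> target (b i \<union> S) \<le> (2 ^ D) ^ (2 * i)" if "S \<noteq> a (Suc i, e)"
  proof -
    \<comment> \<open>\<open>a_other\<close> keeps the negative exceptional point of the sibling
      cube over the same base out of this cube.\<close>
    have "S \<noteq> a (Suc i, e')" for e'
      using that a_other[of i e] S i by (cases "e' = e") auto
    then have "\<not> (\<exists>e'. i < L \<and> b i \<union> S = b i \<union> a (Suc i, e'))"
      using eq[of "Suc i"] i by auto
    moreover have "b i \<union> S \<in> pos_points"
      using proper_pointsI[of "(i, e)" "{..<L} \<times> UNIV" S F "\<lambda>k. b (fst k)"] S i by simp
    moreover have "(1::int) \<le> (2 ^ D) ^ (2 * i)" by simp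
    ultimately show ?thesis unfolding target_def row by auto
  qed
qed

lemma target_neg:
  assumes j: "1 \<le> j" "j < L" and T: "T \<subset> G (j, e)"
  shows "T = b j \<Longrightarrow> target (a (j, e) \<union> T) = (2 ^ D) ^ (2 * j)"
    and "T \<noteq> b j \<Longrightarrow> target (a (j, e) \<union> T) < 0 \<and> - target (a (j, e) \<union> T) \<le> (2 ^ D) ^ (2 * j - 1)"
proof -
  have TB: "T \<subseteq> B" using T G_sub[of "(j, e)"] j by auto
  have aA: "a (j, e) \<subseteq> A" using a_sub' j by auto
  let ?X = "a (j, e) \<union> T"
  have XB: "?X \<inter> B = T" using pointG(2)[of "(j, e)" T] T j by auto
  have eq: "?X = b i \<union> a (k, e') \<longleftrightarrow> T = b i \<and> j = k \<and> e = e'" if "i < L" "1 \<le> k" "k \<le> L" for i k e'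
  proof
    assume "?X = b i \<union> a (k, e')"
    then have "T \<union> a (j, e) = b i \<union> a (k, e')" by (simp only: Un_commute)
    note union_eqD[OF aA a_sub'[OF that(2,3)] TB b_sub'[OF that(1)] this]
    then show "T = b i \<and> j = k \<and> e = e'" using a_inj[of j k e e'] that j by simp
  qed (simp add: Un_commute)
  show "target ?X = (2 ^ D) ^ (2 * j)" if "T = b j"
  proof -
    have "row ?X = j" using row_eq j XB that by blast
    then show ?thesis unfolding target_def using that j eq by auto
  qed
  show "target ?X < 0 \<and> - target ?X \<le> (2 ^ D) ^ (2 * j - 1)" if Tj: "T \<noteq> b j"
  proof (cases "T = b (j - 1)")
    case True
    have row: "row ?X = j - 1" using row_eq[of "j - 1" ?X] j XB True by simp
    have "\<not> (\<exists>e'. 1 \<le> j - 1 \<and> j - 1 < L \<and> ?X = b (j - 1) \<union> a (j - 1, e'))"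
      using eq[of "j - 1" "j - 1"] j by auto
    moreover have "\<exists>e'. j - 1 < L \<and> ?X = b (j - 1) \<union> a (Suc (j - 1), e')"
      using True j by (intro exI[of _ e]) auto
    ultimately have "target ?X = - ((2 ^ D) ^ (2 * (j - 1) + 1))"
      unfolding target_def row by (simp only: if_False if_True)
    moreover have "2 * (j - 1) + 1 = 2 * j - 1" using j by simp
    ultimately have "target ?X = - ((2 ^ D) ^ (2 * j - 1))" by (simp only:)
    then show ?thesis by simp
  next
    case False
    have "\<not> (\<exists>e'. 1 \<le> row ?X \<and> row ?X < L \<and> ?X = b (row ?X) \<union> a (row ?X, e'))"
      using eq[of "row ?X" "row ?X"] Tj by auto
    moreover have "\<not> (\<exists>e'. row ?X < L \<and> ?X = b (row ?X) \<union> a (Suc (row ?X), e'))"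
    proof
      assume "\<exists>e'. row ?X < L \<and> ?X = b (row ?X) \<union> a (Suc (row ?X), e')"
      then obtain e' where e': "row ?X < L" "?X = b (row ?X) \<union> a (Suc (row ?X), e')" by blast
      then have "1 \<le> Suc (row ?X)" "Suc (row ?X) \<le> L" by simp_all
      from iffD1[OF eq[OF e'(1) this] e'(2)] have "T = b (row ?X)" "j - 1 = row ?X" by linarith+
      then show False using False by metis
    qed
    \<comment> \<open>By \<open>cross\<close>, a proper point shared with a positive cube has
      \<open>B\<close>-part \<open>b j\<close> or \<open>b (j - 1)\<close>. Both are excluded here,
      so the default \<open>- 1\<close> applies.\<close>
    moreover have "?X \<notin> pos_points"
    proof
      assume "?X \<in> pos_points"
      then obtain i e' S where i: "i < L" "S \<subset> F (i, e')" "?X = b i \<union> S"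
        unfolding proper_points_def by auto
      have SA: "S \<subseteq> A" using i F_sub[of "(i, e')"] by auto
      have "a (j, e) = S" "T = b i"
        using union_eqD[OF aA SA TB b_sub'[OF i(1)]] i(3) by (auto simp: Un_commute)
      then show False
        using cross[of i j e e'] i j T Tj False by auto
    qed
    ultimately have "target ?X = - 1" unfolding target_def by (simp only: if_False)
    then show ?thesis by simp
  qed
qed

lemma finite_sub: "X \<subseteq> A \<or> X \<subseteq> B \<Longrightarrow> finite X"
  using A_V B_V finite_V by (meson finite_subset)

lemma cube_sum_pos:
  assumes "polyfn V (D - 1) p" "i < L"
  shows "(\<Sum>S\<in>Pow (F (i, e)). (- 1) ^ card (b i \<union> S) * p (b i \<union> S)) = 0"
proof (rule signed_cube_sum[OF assms(1)])
  show "D - 1 < card (F (i, e))" using F_card[of "(i, e)"] assms w_le by auto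
  show "b i \<inter> F (i, e) = {}" using F_sub[of "(i, e)"] b_sub'[of i] assms disj by fastforce
qed (use F_sub[of "(i, e)"] b_sub'[of i] assms finite_sub in auto)

lemma cube_sum_neg:
  assumes "polyfn V (D - 1) p" "1 \<le> j" "j < L"
  shows "(\<Sum>S\<in>Pow (G (j, e)). (- 1) ^ card (a (j, e) \<union> S) * p (a (j, e) \<union> S)) = 0"
proof (rule signed_cube_sum[OF assms(1)])
  show "D - 1 < card (G (j, e))" using G_card[of "(j, e)"] assms w_le by auto
  show "a (j, e) \<inter> G (j, e) = {}" using G_sub[of "(j, e)"] a_sub'[of j e] assms disj by fastforce
qed (use G_sub[of "(j, e)"] a_sub'[of j e] assms finite_sub in auto)

text \<open>Interpolating \<open>target\<close> times the parity settles the proper points. The top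
  corners follow from \<open>cube_top_positive\<close>, since consecutive powers of
  \<open>2 ^ D\<close> differ by exactly the factor it requires; for the second family it is applied
  to the negated values.\<close>

lemma exists_sign_pattern:
  "\<exists>p. polyfn V (D - 1) p \<and>
     (\<forall>i e S. i < L \<longrightarrow> S \<subseteq> F (i, e) \<longrightarrow> S \<noteq> a (Suc i, e) \<longrightarrow>
        0 < (- 1) ^ card (b i \<union> S) * p (b i \<union> S)) \<and>
     (\<forall>j e T. 1 \<le> j \<longrightarrow> j < L \<longrightarrow> T \<subseteq> G (j, e) \<longrightarrow> T \<noteq> b j \<longrightarrow>
        (- 1) ^ card (a (j, e) \<union> T) * p (a (j, e) \<union> T) < 0)"
proof -
  obtain k p where k: "k > 0" and p: "polyfn V (D - 1) p" and
    val: "\<And>u. u \<in> pos_points \<union> neg_points \<Longrightarrow> p u = k * ((- 1) ^ card u * target u)"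
    using interpolation[of "\<lambda>u. (- 1) ^ card u * target u"] by blast
  have sval: "(- 1) ^ card u * p u = k * target u" if "u \<in> pos_points \<union> neg_points" for u
    using val[OF that] by (cases "even (card u)") simp_all
  have pv: "(- 1) ^ card (b i \<union> S) * p (b i \<union> S) = k * target (b i \<union> S)"
    if "i < L" "S \<subset> F (i, e)" for i S e
    using proper_pointsI[of "(i, e)" "{..<L} \<times> UNIV" S F "\<lambda>k. b (fst k)"] that by (intro sval) simp
  have nv: "(- 1) ^ card (a (j, e) \<union> T) * p (a (j, e) \<union> T) = k * target (a (j, e) \<union> T)"
    if "1 \<le> j" "j < L" "T \<subset> G (j, e)" for j T e
    using proper_pointsI[of "(j, e)" "{1..<L} \<times> UNIV" T G a] that by (intro sval) simp
  show ?thesis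
  proof (intro exI[of _ p] conjI allI impI)
    fix i e S assume i: "i < L" and S: "S \<subseteq> F (i, e)" "S \<noteq> a (Suc i, e)"
    show "0 < (- 1) ^ card (b i \<union> S) * p (b i \<union> S)"
    proof (cases "S = F (i, e)")
      case False
      then show ?thesis using pv[of i S e] target_pos(2)[of i S e] S i k by auto
    next
      case True
      have "0 < (- 1) ^ card (b i \<union> F (i, e)) * p (b i \<union> F (i, e))"
      proof (rule cube_top_positive[where v = "\<lambda>S. (- 1) ^ card (b i \<union> S) * p (b i \<union> S)"
            and E = "a (Suc i, e)" and m = "k * (2 ^ D) ^ (2 * i + 1)"
            and m' = "k * (2 ^ D) ^ (2 * i)"])
        show "finite (F (i, e))" using F_sub[of "(i, e)"] i finite_sub by auto
        show "a (Suc i, e) \<subset> F (i, e)" using a_next i by auto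
        show "(\<Sum>S\<in>Pow (F (i, e)). (- 1) ^ card (b i \<union> S) * p (b i \<union> S)) = 0"
          using cube_sum_pos p i by blast
        show "(- 1) ^ card (b i \<union> a (Suc i, e)) * p (b i \<union> a (Suc i, e)) = - (k * (2 ^ D) ^ (2 * i + 1))"
          using pv[of i "a (Suc i, e)" e] target_pos(1)[of i _ e] a_next[of i e] i by simp
        show "(- 1) ^ card (b i \<union> S) * p (b i \<union> S) \<le> k * (2 ^ D) ^ (2 * i)"
          if "S \<subset> F (i, e)" "S \<noteq> a (Suc i, e)" for S
          using pv[of i S e] target_pos(2)[of i S e] that i k by auto
        show "0 < k * (2 ^ D) ^ (2 * i)" using k by simp
        show "2 ^ card (F (i, e)) * (k * (2 ^ D) ^ (2 * i)) \<le> k * (2 ^ D) ^ (2 * i + 1)"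
          using F_card[of "(i, e)"] i by simp
      qed
      then show ?thesis using True by simp
    qed
  next
    fix j e T assume j: "1 \<le> j" "j < L" and T: "T \<subseteq> G (j, e)" "T \<noteq> b j"
    show "(- 1) ^ card (a (j, e) \<union> T) * p (a (j, e) \<union> T) < 0"
    proof (cases "T = G (j, e)")
      case False
      then have "T \<subset> G (j, e)" using T by auto
      then show ?thesis
        using nv[of j T e] target_neg(2)[of j T e] T j k by (simp add: mult_pos_neg)
    next
      case True
      have "0 < - ((- 1) ^ card (a (j, e) \<union> G (j, e)) * p (a (j, e) \<union> G (j, e)))"
      proof (rule cube_top_positive[where v = "\<lambda>S. - ((- 1) ^ card (a (j, e) \<union> S) * p (a (j, e) \<union> S))"
            and E = "b j" and m = "k * (2 ^ D) ^ (2 * j)"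
            and m' = "k * (2 ^ D) ^ (2 * j - 1)"])
        show "finite (G (j, e))" using G_sub[of "(j, e)"] j finite_sub by auto
        show "b j \<subset> G (j, e)" using b_stay j by auto
        show "(\<Sum>S\<in>Pow (G (j, e)). - ((- 1) ^ card (a (j, e) \<union> S) * p (a (j, e) \<union> S))) = 0"
          using cube_sum_neg[OF p j, of e] by (simp add: sum_negf)
        show "- ((- 1) ^ card (a (j, e) \<union> b j) * p (a (j, e) \<union> b j)) = - (k * (2 ^ D) ^ (2 * j))"
          using nv[of j "b j" e] target_neg(1)[of j _ e] b_stay[of j e] j by simp
        show "- ((- 1) ^ card (a (j, e) \<union> T) * p (a (j, e) \<union> T)) \<le> k * (2 ^ D) ^ (2 * j - 1)"
          if "T \<subset> G (j, e)" "T \<noteq> b j" for T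
        proof -
          have "k * (- target (a (j, e) \<union> T)) \<le> k * (2 ^ D) ^ (2 * j - 1)"
            using target_neg(2)[of j T e] that j k by (intro mult_left_mono) auto
          then show ?thesis using nv[of j T e] that j by simp
        qed
        show "0 < k * (2 ^ D) ^ (2 * j - 1)" using k by simp
        have "(2 ^ D) ^ (2 * j) = (2 ^ D) * (2 ^ D :: int) ^ (2 * j - 1)"
          using j by (simp flip: power_Suc)
        then show "2 ^ card (G (j, e)) * (k * (2 ^ D) ^ (2 * j - 1)) \<le> k * (2 ^ D) ^ (2 * j)"
          using G_card[of "(j, e)"] j by simp
      qed
      then show ?thesis using True by simp
    qed
  qed (fact p)
qed

text \<open>The comparison with \<open>0\<close> is not strict, so \<open>y\<close> may vanish where
  \<open>x\<close> is positive. For odd \<open>n\<close> a positive signed value means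
  \<open>x < 0\<close>, which forces \<open>y \<le> - 1\<close>; this supplies the first nonzero
  value for the growth argument.\<close>

lemma same_sign_nonneg:
  fixes x y :: int
  assumes "0 \<le> x \<longleftrightarrow> 0 \<le> y"
  shows "0 < (- 1) ^ n * x \<Longrightarrow> 0 \<le> (- 1) ^ n * y" "(- 1) ^ n * x < 0 \<Longrightarrow> (- 1) ^ n * y \<le> 0"
    and "odd n \<Longrightarrow> 0 < (- 1) ^ n * x \<Longrightarrow> 1 \<le> \<bar>(- 1) ^ n * y\<bar>"
  using assms by (cases "even n"; auto)+

text \<open>An \<open>F\<close>-cube makes its exceptional value at least the sum of the values at
  \<open>a (i, True)\<close> and \<open>a (i, False)\<close>, and a \<open>G\<close>-cube carries a
  value from base \<open>b i\<close> to \<open>b (Suc i)\<close> without loss. Hence the value at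
  \<open>b i \<union> a (Suc i, e)\<close> is at least \<open>2 ^ i\<close> for both
  \<open>e\<close>.\<close>

theorem exponential_values:
  "\<exists>p. polyfn V (D - 1) p \<and> (\<forall>p'. polyfn V (D - 1) p' \<and> (\<forall>X. X \<subseteq> V \<longrightarrow> (0 \<le> p X \<longleftrightarrow> 0 \<le> p' X)) \<longrightarrow>
     (\<exists>X. X \<subseteq> V \<and> 2 ^ (L - 1) \<le> \<bar>p' X\<bar>))"
proof -
  obtain p where p: "polyfn V (D - 1) p" and
    pos': "\<forall>i e S. i < L \<longrightarrow> S \<subseteq> F (i, e) \<longrightarrow> S \<noteq> a (Suc i, e) \<longrightarrow>
        0 < (- 1) ^ card (b i \<union> S) * p (b i \<union> S)" and
    neg': "\<forall>j e T. 1 \<le> j \<longrightarrow> j < L \<longrightarrow> T \<subseteq> G (j, e) \<longrightarrow> T \<noteq> b j \<longrightarrow>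
        (- 1) ^ card (a (j, e) \<union> T) * p (a (j, e) \<union> T) < 0"
    using exists_sign_pattern by (elim exE conjE)
  note pos = pos'[rule_format] and neg = neg'[rule_format]
  have "\<exists>X. X \<subseteq> V \<and> 2 ^ (L - 1) \<le> \<bar>p' X\<bar>"
    if p': "polyfn V (D - 1) p'" and same: "\<And>X. X \<subseteq> V \<Longrightarrow> 0 \<le> p X \<longleftrightarrow> 0 \<le> p' X" for p'
  proof -
    have pV: "b i \<union> S \<subseteq> V" if "i < L" "S \<subseteq> F (i, e)" for i S e
      using that b_sub'[of i] F_sub[of "(i, e)"] A_V B_V by auto
    have nV: "a (j, e) \<union> T \<subseteq> V" if "1 \<le> j" "j < L" "T \<subseteq> G (j, e)" for j T e
      using that a_sub'[of j e] G_sub[of "(j, e)"] A_V B_V by auto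
    have grow_pos: "(\<Sum>S\<in>X. \<bar>(- 1) ^ card (b i \<union> S) * p' (b i \<union> S)\<bar>) \<le> \<bar>p' (b i \<union> a (Suc i, e))\<bar>"
      if i: "i < L" and X: "X \<subseteq> Pow (F (i, e)) - {a (Suc i, e)}" for i e X
    proof -
      have "(\<Sum>S\<in>X. \<bar>(- 1) ^ card (b i \<union> S) * p' (b i \<union> S)\<bar>)
          \<le> \<bar>(- 1) ^ card (b i \<union> a (Suc i, e)) * p' (b i \<union> a (Suc i, e))\<bar>"
      proof (rule cube_growth[OF _ _ cube_sum_pos[OF p' i] _ X])
        show "finite (F (i, e))" using F_sub[of "(i, e)"] i finite_sub by auto
        show "a (Suc i, e) \<in> Pow (F (i, e))" using a_next[of i e] i by auto
        show "0 \<le> (- 1) ^ card (b i \<union> S) * p' (b i \<union> S)"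
          if "S \<subseteq> F (i, e)" "S \<noteq> a (Suc i, e)" for S
          using same_sign_nonneg(1)[OF same[OF pV]] pos[of i S e] that i by blast
      qed
      then show ?thesis by (simp add: abs_mult power_abs)
    qed
    have grow_neg: "\<bar>p' (b i \<union> a (Suc i, e))\<bar> \<le> \<bar>p' (b (Suc i) \<union> a (Suc i, e))\<bar>"
      if i: "Suc i < L" for i e
    proof -
      let ?v = "\<lambda>S. - ((- 1) ^ card (a (Suc i, e) \<union> S) * p' (a (Suc i, e) \<union> S))"
      have "(\<Sum>S\<in>{b i}. \<bar>?v S\<bar>) \<le> \<bar>?v (b (Suc i))\<bar>"
      proof (rule cube_growth[where v = ?v])
        show "finite (G (Suc i, e))" using G_sub[of "(Suc i, e)"] i finite_sub by auto
        show "b (Suc i) \<in> Pow (G (Suc i, e))" using b_stay[of "Suc i" e] i by auto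
        show "(\<Sum>S\<in>Pow (G (Suc i, e)). ?v S) = 0"
          using cube_sum_neg[OF p', of "Suc i" e] i by (simp add: sum_negf)
        show "{b i} \<subseteq> Pow (G (Suc i, e)) - {b (Suc i)}"
          using b_prev[OF i, of e] b_inj[of i "Suc i"] i by auto
        show "0 \<le> ?v S" if "S \<subseteq> G (Suc i, e)" "S \<noteq> b (Suc i)" for S
          using same_sign_nonneg(2)[OF same[OF nV[of "Suc i" S e]]] neg[of "Suc i" S e] that i by simp
      qed
      then show ?thesis by (simp add: abs_mult power_abs Un_commute)
    qed
    have "2 ^ i \<le> \<bar>p' (b i \<union> a (Suc i, e))\<bar>" if "i < L" for i e
      using that
    proof (induction i arbitrary: e)
      case 0
      have "card (F (0, e)) \<noteq> 0" using F_card[of "(0, e)"] 0 w_le by auto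
      then obtain z where z: "z \<in> F (0, e)" by fastforce
      have zb: "z \<notin> b 0" "finite (b 0)"
        using z F_sub[of "(0, e)"] b_sub'[of 0] 0 disj finite_sub by auto
      \<comment> \<open>Odd size of \<open>b 0 \<union> S\<close> forces a nonzero value, and
        \<open>w \<ge> 2\<close> keeps this point different from the exceptional one.\<close>
      define S where "S = (if odd (card (b 0)) then {} else {z})"
      have S: "S \<subseteq> F (0, e)" "odd (card (b 0 \<union> S))" using z zb by (auto simp: S_def)
      have "card S \<le> 1" by (simp add: S_def)
      then have Sne: "S \<noteq> a (Suc 0, e)" using a_card'[of 1 e] w_ge 0 by auto
      have "1 \<le> \<bar>(- 1) ^ card (b 0 \<union> S) * p' (b 0 \<union> S)\<bar>"
        using same_sign_nonneg(3)[OF same[OF pV[OF 0 S(1)]] S(2)] pos[OF 0 S(1) Sne] by blast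
      also have "\<dots> \<le> \<bar>p' (b 0 \<union> a (Suc 0, e))\<bar>"
        using grow_pos[of 0 "{S}" e] S Sne 0 by simp
      finally show ?case by simp
    next
      case (Suc i)
      let ?X = "{a (Suc i, True), a (Suc i, False)}"
      have ne: "a (Suc i, True) \<noteq> a (Suc i, False)" using a_inj[of "Suc i" "Suc i"] Suc.prems by auto
      have "?X \<subseteq> Pow (F (Suc i, e)) - {a (Suc (Suc i), e)}"
        using a_stay[of "Suc i"] a_inj[of "Suc i" "Suc (Suc i)"] Suc.prems by auto
      from grow_pos[OF Suc.prems this]
      have "(\<Sum>S\<in>?X. \<bar>(- 1) ^ card (b (Suc i) \<union> S) * p' (b (Suc i) \<union> S)\<bar>)
          \<le> \<bar>p' (b (Suc i) \<union> a (Suc (Suc i), e))\<bar>" .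
      then have "\<bar>p' (b (Suc i) \<union> a (Suc i, True))\<bar> + \<bar>p' (b (Suc i) \<union> a (Suc i, False))\<bar>
          \<le> \<bar>p' (b (Suc i) \<union> a (Suc (Suc i), e))\<bar>"
        using ne by (simp add: abs_mult power_abs)
      moreover have "2 ^ i \<le> \<bar>p' (b (Suc i) \<union> a (Suc i, e'))\<bar>" for e'
        using Suc.IH[of e'] grow_neg[of i e'] Suc.prems by linarith
      note this[of True] this[of False]
      ultimately show ?case unfolding power_Suc by linarith
    qed
    from this[of "L - 1" True] show ?thesis
      using L_pos pV[of "L - 1" "a (Suc (L - 1), True)" True] a_next[of "L - 1" True]
      by (intro exI[of _ "b (L - 1) \<union> a (Suc (L - 1), True)"]) auto
  qed
  then show ?thesis using p by (intro exI[of _ p]) simp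
qed

end

subsection \<open>Cubes indexed by words\<close>

text \<open>The Boolean is the side, \<open>True\<close> for \<open>A\<close> and
  \<open>False\<close> for \<open>B\<close>. \<open>Core s m x\<close> is element \<open>x\<close>
  of block \<open>m\<close>; \<open>Tag s r j\<close> is the \<open>j\<close>-th auxiliary variable
  for the residue \<open>r\<close> of a word index modulo \<open>Q\<close>.\<close>

datatype coord = Core bool nat nat | Tag bool nat nat

definition core :: "bool \<Rightarrow> nat set \<Rightarrow> (nat \<Rightarrow> nat set) \<Rightarrow> coord set" where
  "core s N X = {Core s m x | m x. m \<in> N \<and> x \<in> X m}"

lemma Core_in_core [simp]: "Core s m x \<in> core s' N X \<longleftrightarrow> s = s' \<and> m \<in> N \<and> x \<in> X m"
  by (auto simp: core_def)

lemma Tag_in_core [simp]: "Tag s m x \<notin> core s' N X"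
  by (auto simp: core_def)

lemma core_eq_image: "core s N X = (\<lambda>(m, x). Core s m x) ` Sigma N X"
  by (auto simp: core_def image_def)

lemma finite_core: "finite N \<Longrightarrow> (\<And>m. m \<in> N \<Longrightarrow> finite (X m)) \<Longrightarrow> finite (core s N X)"
  unfolding core_eq_image by (intro finite_imageI finite_SigmaI) auto

lemma card_core:
  assumes "finite N" "\<And>m. m \<in> N \<Longrightarrow> finite (X m)"
  shows "card (core s N X) = (\<Sum>m\<in>N. card (X m))"
  unfolding core_eq_image using assms
  by (subst card_image) (auto simp: inj_on_def intro: card_SigmaI)

lemma sum_blocks_le:
  fixes f :: "nat \<Rightarrow> nat"
  assumes "finite N" "\<And>m. m \<in> N \<Longrightarrow> f m \<le> h" "m0 \<in> N" "f m0 + 3 \<le> h"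
  shows "(\<Sum>m\<in>N. f m) + 3 \<le> card N * h"
proof -
  have "(\<Sum>m\<in>N. f m) = f m0 + (\<Sum>m\<in>N - {m0}. f m)"
    using assms by (intro sum.remove) auto
  moreover have "(\<Sum>m\<in>N - {m0}. f m) \<le> card (N - {m0}) * h"
    using sum_bounded_above[of "N - {m0}" f h] assms by auto
  moreover have "card N = Suc (card (N - {m0}))"
    using assms by (metis card.remove)
  ultimately show ?thesis using assms(4) by simp
qed

text \<open>The degree budget \<open>D - 2 - card S\<close> equals \<open>c + t - 2\<close>, where \<open>S\<close> misses \<open>c\<close> core directions
  and \<open>t\<close> tags. Every cube containing \<open>S\<close> agrees with cube \<open>k\<close> in at least \<open>M * h - c\<close> core
  elements, hence \<open>c - 2\<close> linear factors in the size of the agreement remove all cubes whose words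
  differ outside the block omitted from the base; the remaining ones are removed by the tag.\<close>

lemma separated_words:
  fixes X :: "'k \<Rightarrow> nat \<Rightarrow> nat set" and e :: "'k \<Rightarrow> nat" and \<tau> :: "'k \<Rightarrow> coord set"
    and \<gamma> :: "'k \<Rightarrow> coord"
  assumes BV: "B \<subseteq> V" and M: "0 < M"
    and X_fin: "\<And>k m. k \<in> K \<Longrightarrow> m < M \<Longrightarrow> finite (X k m)"
    and X_card: "\<And>k m. k \<in> K \<Longrightarrow> m < M \<Longrightarrow> card (X k m) = h"
    and e_lt: "\<And>k. k \<in> K \<Longrightarrow> e k < M"
    and \<tau>_fin: "\<And>k. k \<in> K \<Longrightarrow> finite (\<tau> k)" and \<tau>_card: "\<And>k. k \<in> K \<Longrightarrow> card (\<tau> k) = \<theta>"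
    and \<tau>_tag: "\<And>k x. k \<in> K \<Longrightarrow> x \<in> \<tau> k \<Longrightarrow> \<exists>i j. x = Tag s i j"
    and \<gamma>_tag: "\<And>k. k \<in> K \<Longrightarrow> \<exists>i j. \<gamma> k = Tag (\<not> s) i j"
    and core_B: "\<And>k. k \<in> K \<Longrightarrow> core (\<not> s) {..<M} (X k) \<subseteq> B" and \<gamma>_B: "\<And>k. k \<in> K \<Longrightarrow> \<gamma> k \<in> B"
    and dist: "\<And>k k' m. k \<in> K \<Longrightarrow> k' \<in> K \<Longrightarrow> m < M \<Longrightarrow> X k m \<noteq> X k' m \<Longrightarrow>
        card (X k m \<inter> X k' m) + 3 \<le> h"
    and same: "\<And>k k'. k \<in> K \<Longrightarrow> k' \<in> K \<Longrightarrow> (\<And>m. m < M \<Longrightarrow> X k m = X k' m) \<Longrightarrow>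
        e k = e k' \<and> (\<gamma> k = \<gamma> k' \<or> 3 \<le> card (\<tau> k - \<tau> k'))"
    and one: "\<And>k k' m0. k \<in> K \<Longrightarrow> k' \<in> K \<Longrightarrow> m0 < M \<Longrightarrow> X k m0 \<noteq> X k' m0 \<Longrightarrow>
        (\<And>m. m < M \<Longrightarrow> m \<noteq> m0 \<Longrightarrow> X k m = X k' m) \<Longrightarrow> \<gamma> k \<noteq> \<gamma> k' \<and> \<not> \<tau> k \<subseteq> \<tau> k'"
  shows "separated V B (M * h + \<theta>) K (\<lambda>k. core s {..<M} (X k) \<union> \<tau> k)
    (\<lambda>k. core (\<not> s) ({..<M} - {e k}) (X k) \<union> {\<gamma> k})"
  unfolding separated_def
proof (intro ballI allI impI)
  fix k S
  assume k: "k \<in> K" and S: "S \<subset> core s {..<M} (X k) \<union> \<tau> k"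
  define F where "F = (\<lambda>k. core s {..<M} (X k) \<union> \<tau> k)"
  define b where "b = (\<lambda>k. core (\<not> s) ({..<M} - {e k}) (X k) \<union> {\<gamma> k})"
  define Sc where "Sc = S \<inter> core s {..<M} (X k)"
  define St where "St = S \<inter> \<tau> k"
  define bad where "bad = (\<lambda>k'. k' \<in> K \<and> S \<subseteq> F k' \<and> b k' \<noteq> b k)"
  have fin_core: "finite (core s' {..<M} (X k'))" if "k' \<in> K" for k' s'
    using X_fin that by (intro finite_core) auto
  have card_Xk: "card (core s {..<M} (X k)) = M * h"
    using X_fin X_card k by (subst card_core) auto
  have disjoint: "core s {..<M} (X k') \<inter> \<tau> k'' = {}" if "k'' \<in> K" for k' k''
    using \<tau>_tag[OF that] by fastforce
  have S_split: "S = Sc \<union> St" using S by (auto simp: Sc_def St_def)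
  have fin: "finite Sc" "finite St"
    unfolding Sc_def St_def using fin_core \<tau>_fin k by auto
  have card_S: "card S = card Sc + card St"
    unfolding S_split using fin disjoint[OF k] by (intro card_Un_disjoint) (auto simp: Sc_def St_def)
  have Sc_le: "card Sc \<le> M * h"
    unfolding Sc_def card_Xk[symmetric] using fin_core k by (intro card_mono) auto
  have St_le: "card St \<le> \<theta>"
    unfolding St_def \<tau>_card[OF k, symmetric] using \<tau>_fin k by (intro card_mono) auto
  define c where "c = M * h - card Sc"
  define t where "t = \<theta> - card St"
  have deg: "M * h + \<theta> - 2 - card S = c + t - 2"
    unfolding c_def t_def using card_S Sc_le St_le by simp
  define Y where "Y = (\<lambda>k' m. X k m \<inter> X k' m)"
  have Y_fin: "finite (Y k' m)" if "m < M" for k' m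
    using X_fin[OF k that] by (simp add: Y_def)
  have Y_le: "card (Y k' m) \<le> h" if "m < M" for k' m
    using X_fin[OF k that] X_card[OF k that] by (auto simp: Y_def intro: card_mono)
  have Y_dist: "card (Y k' m) + 3 \<le> h" if "k' \<in> K" "m < M" "X k m \<noteq> X k' m" for k' m
    unfolding Y_def using dist[OF k that] .
  have overlap: "card Sc \<le> (\<Sum>m<M. card (Y k' m))" if "k' \<in> K" "S \<subseteq> F k'" for k'
  proof -
    have "Sc \<subseteq> core s {..<M} (Y k')"
    proof
      fix z assume z: "z \<in> Sc"
      then obtain m x where mx: "z = Core s m x" "m < M" "x \<in> X k m"
        by (auto simp: Sc_def core_def)
      have "z \<in> F k'" using z that by (auto simp: Sc_def)
      then have "x \<in> X k' m"
        using mx \<tau>_tag[OF that(1)] by (auto simp: F_def)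
      then show "z \<in> core s {..<M} (Y k')" using mx by (simp add: Y_def)
    qed
    then have "card Sc \<le> card (core s {..<M} (Y k'))"
      using Y_fin by (intro card_mono finite_core) auto
    then show ?thesis using Y_fin by (subst (asm) card_core) auto
  qed
  have tags_sub: "St \<subseteq> \<tau> k'" if "k' \<in> K" "S \<subseteq> F k'" for k'
  proof
    fix z assume z: "z \<in> St"
    then obtain i j where "z = Tag s i j" using \<tau>_tag[OF k, of z] by (auto simp: St_def)
    then show "z \<in> \<tau> k'" using z that by (auto simp: St_def F_def)
  qed
  have t_ge: "card (\<tau> k - \<tau> k') \<le> t" if "k' \<in> K" "S \<subseteq> F k'" for k'
  proof -
    have "card (\<tau> k - \<tau> k') \<le> card (\<tau> k - St)"
      using tags_sub[OF that] \<tau>_fin[OF k] by (intro card_mono) auto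
    also have "\<dots> = t"
      unfolding t_def using \<tau>_fin[OF k] fin \<tau>_card[OF k] by (subst card_Diff_subset) (auto simp: St_def)
    finally show ?thesis .
  qed
  have differ: "3 \<le> c" if "k' \<in> K" "S \<subseteq> F k'" "m < M" "X k m \<noteq> X k' m" for k' m
  proof -
    have "(\<Sum>m\<in>{..<M}. card (Y k' m)) + 3 \<le> card {..<M} * h"
      using Y_le Y_dist that by (intro sum_blocks_le[where ?m0.0 = m]) auto
    then show ?thesis unfolding c_def using overlap[OF that(1,2)] by simp
  qed
  have agree: "\<gamma> k' \<noteq> \<gamma> k \<and> 3 \<le> t" if "bad k'" "\<And>m. m < M \<Longrightarrow> X k m = X k' m" for k'
  proof -
    have k': "k' \<in> K" "S \<subseteq> F k'" "b k' \<noteq> b k" using that(1) by (auto simp: bad_def)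
    note sm = same[OF k k'(1) that(2)]
    have "core (\<not> s) ({..<M} - {e k'}) (X k') = core (\<not> s) ({..<M} - {e k}) (X k)"
      using sm that(2) unfolding core_def by auto
    then have "\<gamma> k' \<noteq> \<gamma> k" using k'(3) by (auto simp: b_def)
    then show ?thesis using sm t_ge[OF k'(1,2)] by auto
  qed
  \<comment> \<open>The base of \<open>k'\<close> hides block \<open>e k'\<close>, so counting
    agreements cannot detect a difference confined to it. The tag \<open>\<gamma>\<close> can, and
    \<open>1 \<le> t\<close> pays for that extra factor.\<close>
  have agree_off: "\<gamma> k' \<noteq> \<gamma> k \<and> 1 \<le> t"
    if "bad k'" "\<And>m. m < M \<Longrightarrow> m \<noteq> e k' \<Longrightarrow> X k m = X k' m" for k'
  proof (cases "X k (e k') = X k' (e k')")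
    case True
    then have "\<And>m. m < M \<Longrightarrow> X k m = X k' m" using that(2) by metis
    from agree[OF that(1) this] show ?thesis by auto
  next
    case False
    have k': "k' \<in> K" "S \<subseteq> F k'" using that(1) by (auto simp: bad_def)
    note on = one[OF k k'(1) e_lt[OF k'(1)] False that(2)]
    then have "\<tau> k - \<tau> k' \<noteq> {}" by auto
    then have "0 < card (\<tau> k - \<tau> k')" using \<tau>_fin[OF k] by (simp add: card_gt_0_iff)
    then show ?thesis using on t_ge[OF k'] by auto
  qed
  have tag_poly: "polyfn V 1 (\<lambda>Z. of_bool (\<gamma> k \<in> Z))"
    using \<gamma>_B[OF k] BV by (intro polyfn_member) auto
  have tag_value: "\<gamma> k \<in> b k' \<longleftrightarrow> \<gamma> k' = \<gamma> k" for k'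
    using \<gamma>_tag[OF k] by (auto simp: b_def)
  have "\<exists>g. polyfn V (c + t - 2) g \<and> (\<forall>Z. g Z = g (Z \<inter> B)) \<and> g (b k) \<noteq> 0 \<and> (\<forall>k'. bad k' \<longrightarrow> g (b k') = 0)"
  proof (cases "c \<le> 2")
    case True
    \<comment> \<open>With \<open>c \<le> 2\<close>, \<open>differ\<close> gives every cube
      containing \<open>S\<close> the word of \<open>k\<close>, so only the tag distinguishes the
      bases.\<close>
    have ag: "\<gamma> k' \<noteq> \<gamma> k \<and> 3 \<le> t" if "bad k'" for k'
    proof (rule agree[OF that])
      show "X k m = X k' m" if "m < M" for m
        using differ[of k' m] \<open>bad k'\<close> that True by (auto simp: bad_def)
    qed
    show ?thesis
    proof (cases "3 \<le> t")
      case True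
      have "polyfn V (c + t - 2) (\<lambda>Z. of_bool (\<gamma> k \<in> Z))"
        using polyfn_mono[OF tag_poly] True by simp
      then show ?thesis
        using ag tag_value \<gamma>_B[OF k] by (intro exI[of _ "\<lambda>Z. of_bool (\<gamma> k \<in> Z)"]) auto
    next
      case False
      then show ?thesis
        using ag by (intro exI[of _ "\<lambda>Z. 1"]) (auto intro: polyfn_const)
    qed
  next
    case False
    define Z0 where "Z0 = core (\<not> s) {..<M} (X k)"
    have Z0: "finite Z0" "Z0 \<subseteq> B" unfolding Z0_def using fin_core core_B k by auto
    \<comment> \<open>The \<open>c - 2\<close> roots run from \<open>card Sc - h\<close> to
      \<open>M * h - h - 3\<close>, the possible agreements of a base that shows a differing block.
      The base of \<open>k\<close> itself agrees in \<open>M * h - h\<close> elements, above all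
      roots.\<close>
    define root where "root = (\<lambda>m. int (card Sc) - int h + int m)"
    define g0 where "g0 = (\<lambda>Z. \<Prod>m<c - 2. int (card (Z \<inter> Z0)) - root m)"
    have g0_poly: "polyfn V (c - 2) g0"
      unfolding g0_def using Z0 BV by (intro polyfn_prod_linear polyfn_diff polyfn_card_Int polyfn_const) auto
    have g0_B: "g0 (Z \<inter> B) = g0 Z" for Z
    proof -
      have "Z \<inter> B \<inter> Z0 = Z \<inter> Z0" using Z0 by auto
      then show ?thesis by (simp add: g0_def)
    qed
    have agreement: "card (b k' \<inter> Z0) = (\<Sum>m\<in>{..<M} - {e k'}. card (Y k' m))" if "k' \<in> K" for k'
    proof -
      have "b k' \<inter> Z0 = core (\<not> s) ({..<M} - {e k'}) (Y k')"
        using \<gamma>_tag[OF that] by (auto simp: b_def Z0_def Y_def core_def)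
      then show ?thesis using Y_fin by (simp only:) (intro card_core, auto)
    qed
    have own: "card (b k \<inter> Z0) + h = M * h"
    proof -
      have "card (b k \<inter> Z0) = (\<Sum>m\<in>{..<M} - {e k}. h)"
        unfolding agreement[OF k] using X_card[OF k] by (intro sum.cong) (auto simp: Y_def)
      also have "\<dots> = (M - 1) * h" using e_lt[OF k] by (simp add: card_Diff_subset)
      finally show ?thesis using M by (cases M) auto
    qed
    have "int (card (b k \<inter> Z0)) - root m \<noteq> 0" if "m < c - 2" for m
      using own that Sc_le False unfolding root_def c_def by linarith
    then have g0_own: "g0 (b k) \<noteq> 0" unfolding g0_def by simp
    have g0_zero: "g0 (b k') = 0"
      if bad': "bad k'" and m: "m < M" "m \<noteq> e k'" "X k m \<noteq> X k' m" for k' m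
    proof -
      have k': "k' \<in> K" "S \<subseteq> F k'" using bad' by (auto simp: bad_def)
      let ?N = "{..<M} - {e k'}"
      have "(\<Sum>m\<in>?N. card (Y k' m)) + 3 \<le> card ?N * h"
        using Y_le Y_dist k' m by (intro sum_blocks_le[where ?m0.0 = m]) auto
      moreover have "card ?N * h + h = M * h"
        using e_lt[OF k'(1)] M by (cases M) (auto simp: card_Diff_subset)
      moreover have "card Sc \<le> card (Y k' (e k')) + (\<Sum>m\<in>?N. card (Y k' m))"
        using overlap[OF k'] sum.remove[of "{..<M}" "e k'" "\<lambda>m. card (Y k' m)"] e_lt[OF k'(1)] by simp
      moreover have "card (Y k' (e k')) \<le> h" using Y_le e_lt[OF k'(1)] by simp
      ultimately have bounds: "card Sc \<le> card (b k' \<inter> Z0) + h" "card (b k' \<inter> Z0) + h + 3 \<le> M * h"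
        unfolding agreement[OF k'(1)] by linarith+
      define m1 where "m1 = card (b k' \<inter> Z0) + h - card Sc"
      have "m1 < c - 2" "int (card (b k' \<inter> Z0)) - root m1 = 0"
        using bounds unfolding m1_def c_def root_def by linarith+
      then show ?thesis unfolding g0_def by (intro prod_zero) auto
    qed
    show ?thesis
    proof (cases "1 \<le> t")
      case True
      have "polyfn V (c - 2 + 1) (\<lambda>Z. g0 Z * of_bool (\<gamma> k \<in> Z))"
        by (intro polyfn_mult g0_poly tag_poly)
      then have "polyfn V (c + t - 2) (\<lambda>Z. g0 Z * of_bool (\<gamma> k \<in> Z))"
        by (rule polyfn_mono) (use True False in linarith)
      moreover have "g0 (b k') * of_bool (\<gamma> k \<in> b k') = 0" if "bad k'" for k'
        using g0_zero[OF that] agree_off[OF that] tag_value[of k'] by fastforce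
      ultimately show ?thesis
        using g0_own g0_B \<gamma>_B[OF k] tag_value[of k]
        by (intro exI[of _ "\<lambda>Z. g0 Z * of_bool (\<gamma> k \<in> Z)"]) auto
    next
      case False
      have "g0 (b k') = 0" if "bad k'" for k'
        using g0_zero[OF that] agree_off[OF that] False by blast
      moreover have "polyfn V (c + t - 2) g0"
        using polyfn_mono[OF g0_poly] False by simp
      ultimately show ?thesis using g0_own g0_B by (intro exI[of _ g0]) simp
    qed
  qed
  then obtain g where "polyfn V (c + t - 2) g" "\<forall>Z. g Z = g (Z \<inter> B)" "g (b k) \<noteq> 0"
    "\<forall>k'. bad k' \<longrightarrow> g (b k') = 0" by (elim exE conjE)
  then show "\<exists>g. polyfn V (M * h + \<theta> - 2 - card S) g \<and> (\<forall>X. g X = g (X \<inter> B)) \<and>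
      g (core (\<not> s) ({..<M} - {e k}) (X k) \<union> {\<gamma> k}) \<noteq> 0 \<and>
      (\<forall>k'\<in>K. S \<subseteq> core s {..<M} (X k') \<union> \<tau> k' \<longrightarrow>
        core (\<not> s) ({..<M} - {e k'}) (X k') \<union> {\<gamma> k'} \<noteq> core (\<not> s) ({..<M} - {e k}) (X k) \<union> {\<gamma> k} \<longrightarrow>
        g (core (\<not> s) ({..<M} - {e k'}) (X k') \<union> {\<gamma> k'}) = 0)"
    unfolding deg bad_def F_def b_def by (intro exI[of _ g] conjI) (assumption | blast)+
qed

section \<open>A ladder of cubes built from a sequence of words\<close>

text \<open>Abstracts a Gray code whose digits are written as codewords. \<open>X_unique\<close>
  makes the index modulo \<open>Q\<close> a checksum: it recovers a word from all blocks but one.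
  This allows bases to hide a block and show a residue instead.\<close>

locale word_sequence =
  fixes M Q q h L :: nat and X :: "nat \<Rightarrow> nat \<Rightarrow> nat set" and pos :: "nat \<Rightarrow> nat"
  assumes M_ge: "2 \<le> M" and Q_ge: "2 \<le> Q" and h_pos: "0 < h" and L_pos': "0 < L"
    and X_sub: "m < M \<Longrightarrow> X i m \<subseteq> {..<q}" and X_card: "m < M \<Longrightarrow> card (X i m) = h"
    and X_dist: "m < M \<Longrightarrow> X i m \<noteq> X j m \<Longrightarrow> card (X i m \<inter> X j m) + 3 \<le> h"
    and pos_less: "i < L \<Longrightarrow> pos i < M"
    and X_step: "i < L \<Longrightarrow> m < M \<Longrightarrow> m \<noteq> pos i \<Longrightarrow> X (Suc i) m = X i m"
    and X_inj: "i \<le> L \<Longrightarrow> j \<le> L \<Longrightarrow> (\<And>m. m < M \<Longrightarrow> X i m = X j m) \<Longrightarrow> i = j"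
    and X_unique: "i \<le> L \<Longrightarrow> j \<le> L \<Longrightarrow> (\<And>m. m < M \<Longrightarrow> m \<noteq> m0 \<Longrightarrow> X i m = X j m)
        \<Longrightarrow> i mod Q = j mod Q \<Longrightarrow> i = j"
begin

text \<open>The first three elements of \<open>tagA\<close> are those of the bases \<open>baseA\<close> on the cube. The constant
  ones pad \<open>tagA\<close> to the size of \<open>tagB\<close>, whose last three separate the two cubes of equal word.\<close>

definition side :: "bool \<Rightarrow> coord set" where
  "side s = core s {..<M} (\<lambda>_. {..<q}) \<union> case_prod (Tag s) ` ({..<Q} \<times> {..<7})"

definition tagA :: "nat \<times> bool \<Rightarrow> coord set" where
  "tagA = (\<lambda>(i, e). {Tag True (i mod Q) 0, Tag True (i mod Q) 1, Tag True (Suc i mod Q) (of_bool e),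
     Tag True 0 2, Tag True 0 3})"

definition tagB :: "nat \<times> bool \<Rightarrow> coord set" where
  "tagB = (\<lambda>(j, e). {Tag False ((j - 1) mod Q) 0, Tag False (j mod Q) 0} \<union>
     Tag False (j mod Q) ` (if e then {1, 2, 3} else {4, 5, 6}))"

definition dirA :: "nat \<times> bool \<Rightarrow> coord set" where
  "dirA k = core True {..<M} (X (fst k)) \<union> tagA k"

definition dirB :: "nat \<times> bool \<Rightarrow> coord set" where
  "dirB k = core False {..<M} (X (fst k)) \<union> tagB k"

text \<open>The hidden block is the one about to change, so \<open>baseB i\<close> fits into the
  cubes of both word \<open>i\<close> and word \<open>Suc i\<close>.\<close>

definition baseB :: "nat \<Rightarrow> coord set" where
  "baseB i = core False ({..<M} - {pos i}) (X i) \<union> {Tag False (i mod Q) 0}"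

text \<open>The hidden block is the one changed last, so \<open>baseA (j, e)\<close> fits the words
  \<open>j - 1\<close> and \<open>j\<close>. The tag records \<open>e\<close> and thereby
  distinguishes the two cubes over \<open>baseB (j - 1)\<close>.\<close>

definition baseA :: "nat \<times> bool \<Rightarrow> coord set" where
  "baseA k = core True ({..<M} - {pos (fst k - 1)}) (X (fst k)) \<union>
     {Tag True (fst k mod Q) (of_bool (snd k))}"

lemma X_fin: "m < M \<Longrightarrow> finite (X i m)"
  using X_sub[of m i] finite_subset by blast

lemma mod_Suc_neq: "Suc i mod Q \<noteq> i mod Q"
  using Q_ge by (simp add: mod_Suc)

lemma Tag_side: "r < Q \<Longrightarrow> k < 7 \<Longrightarrow> Tag s r k \<in> side s"
  by (auto simp: side_def)

lemma mod_less_Q [simp]: "i mod Q < Q"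
  using Q_ge by simp

lemma core_side: "N \<subseteq> {..<M} \<Longrightarrow> core s N (X i) \<subseteq> side s"
  using X_sub by (fastforce simp: side_def core_def)

lemma finite_side: "finite (side s)"
  unfolding side_def by (auto intro!: finite_core)

lemma card_side_le: "card (side s) \<le> M * q + 7 * Q"
proof -
  have "card (core s {..<M} (\<lambda>_. {..<q})) = M * q"
    by (subst card_core) auto
  moreover have "card (case_prod (Tag s) ` ({..<Q} \<times> {..<7::nat})) \<le> card ({..<Q} \<times> {..<7::nat})"
    by (rule card_image_le) simp
  ultimately show ?thesis
    unfolding side_def using card_Un_le[of "core s {..<M} (\<lambda>_. {..<q})" "case_prod (Tag s) ` ({..<Q} \<times> {..<7})"]
    by simp
qed

lemma side_disjoint: "side True \<inter> side False = {}"
  by (auto simp: side_def core_def)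

lemma tagA_props: "tagA k \<subseteq> side True" "card (tagA k) = 5" "finite (tagA k)"
    "x \<in> tagA k \<Longrightarrow> \<exists>i j. x = Tag True i j"
proof -
  obtain i e where k: "k = (i, e)" by (cases k)
  have "Suc i mod Q \<noteq> i mod Q" by (rule mod_Suc_neq)
  then show "card (tagA k) = 5" unfolding k tagA_def by (cases e) auto
  show "tagA k \<subseteq> side True"
    unfolding k tagA_def using Q_ge by (cases e) (auto intro!: Tag_side)
  show "finite (tagA k)" "x \<in> tagA k \<Longrightarrow> \<exists>i j. x = Tag True i j"
    unfolding k tagA_def by auto
qed

lemma tagB_props:
  assumes "1 \<le> fst k"
  shows "tagB k \<subseteq> side False" "card (tagB k) = 5" "finite (tagB k)"
    "x \<in> tagB k \<Longrightarrow> \<exists>i j. x = Tag False i j"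
proof -
  obtain j e where k: "k = (j, e)" by (cases k)
  have "j mod Q \<noteq> (j - 1) mod Q" using mod_Suc_neq[of "j - 1"] assms k by simp
  then show "card (tagB k) = 5" unfolding k tagB_def by (cases e) auto
  show "tagB k \<subseteq> side False"
    unfolding k tagB_def by (cases e) (auto intro!: Tag_side)
  show "finite (tagB k)" "x \<in> tagB k \<Longrightarrow> \<exists>i j. x = Tag False i j"
    unfolding k tagB_def by auto
qed

lemma core_tag_disjoint: "(\<And>x. x \<in> T \<Longrightarrow> \<exists>i j. x = Tag s i j) \<Longrightarrow> core s' N Y \<inter> T = {}"
  by (fastforce simp: core_def)

lemma card_core_full: "card (core s {..<M} (X i)) = M * h"
  using X_fin X_card by (subst card_core) auto

lemma card_core_omit: "p < M \<Longrightarrow> card (core s ({..<M} - {p}) (X i)) = (M - 1) * h"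
  using X_fin X_card by (subst card_core) (auto simp: card_Diff_subset)

lemma card_dirA: "card (dirA k) = M * h + 5"
  unfolding dirA_def using X_fin tagA_props(2,3)[of k]
  by (subst card_Un_disjoint)
    (auto simp: card_core_full core_tag_disjoint[OF tagA_props(4)] intro!: finite_core)

lemma card_dirB: "1 \<le> fst k \<Longrightarrow> card (dirB k) = M * h + 5"
  unfolding dirB_def using X_fin tagB_props(2,3)[of k]
  by (subst card_Un_disjoint)
    (auto simp: card_core_full core_tag_disjoint[OF tagB_props(4)] intro!: finite_core)

lemma card_baseB: "i < L \<Longrightarrow> card (baseB i) = (M - 1) * h + 1"
  unfolding baseB_def using X_fin pos_less[of i]
  by (subst card_Un_disjoint) (auto simp: card_core_omit intro!: finite_core)

lemma card_baseA: "1 \<le> j \<Longrightarrow> j \<le> L \<Longrightarrow> card (baseA (j, e)) = (M - 1) * h + 1"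
  unfolding baseA_def using X_fin pos_less[of "j - 1"]
  by (subst card_Un_disjoint) (auto simp: card_core_omit intro!: finite_core)

lemma dirA_side: "dirA k \<subseteq> side True"
  unfolding dirA_def using core_side tagA_props(1) by auto

lemma dirB_side: "1 \<le> fst k \<Longrightarrow> dirB k \<subseteq> side False"
  unfolding dirB_def using core_side tagB_props(1) by auto

lemma baseB_side: "baseB i \<subseteq> side False"
  unfolding baseB_def using core_side[of "{..<M} - {pos i}" False i] by (auto intro!: Tag_side)

lemma baseA_side: "baseA k \<subseteq> side True"
  unfolding baseA_def using core_side[of "{..<M} - {pos (fst k - 1)}" True "fst k"]
  by (auto intro!: Tag_side)

lemma X_eqI: "m < M \<Longrightarrow> X i m \<subseteq> X j m \<Longrightarrow> X i m = X j m"
  using X_dist[of m i j] X_card[of m i] by (force simp: Int_absorb2)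

lemma core_subset_agree:
  assumes "core s ({..<M} - {p}) (X i) \<subseteq> core s N (X j) \<union> T" "\<And>m x. Core s m x \<notin> T"
    and "m < M" "m \<noteq> p"
  shows "X i m = X j m"
proof (rule X_eqI)
  show "X i m \<subseteq> X j m"
  proof
    fix x assume "x \<in> X i m"
    then have "Core s m x \<in> core s ({..<M} - {p}) (X i)" using assms by simp
    then have "Core s m x \<in> core s N (X j) \<union> T" using assms(1) by (rule rev_subsetD)
    then show "x \<in> X j m" using assms(2) by simp
  qed
qed fact

lemma baseA_agree:
  assumes "baseA (j, e) \<subseteq> core True N (X i) \<union> T" "\<And>m x. Core True m x \<notin> T"
    and "m < M" "m \<noteq> pos (j - 1)"
  shows "X j m = X i m"
  using assms by (intro core_subset_agree[of True "pos (j - 1)" j N i T m]) (auto simp: baseA_def)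

lemma baseB_agree:
  assumes "baseB i \<subseteq> core False N (X j) \<union> T" "\<And>m x. Core False m x \<notin> T"
    and "m < M" "m \<noteq> pos i"
  shows "X i m = X j m"
  using assms by (intro core_subset_agree[of False "pos i" i N j T m]) (auto simp: baseB_def)

lemma baseB_inj: "i < L \<Longrightarrow> j < L \<Longrightarrow> baseB i = baseB j \<Longrightarrow> i = j"
proof -
  assume ij: "i < L" "j < L" and eq: "baseB i = baseB j"
  have "Tag False (i mod Q) 0 \<in> baseB j" unfolding eq[symmetric] by (simp add: baseB_def)
  then have "i mod Q = j mod Q" by (simp add: baseB_def)
  moreover have "X i m = X j m" if "m < M" "m \<noteq> pos i" for m
    using that by (intro baseB_agree[of i "{..<M} - {pos j}" j "{Tag False (j mod Q) 0}"])
      (auto simp: eq, auto simp: baseB_def)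
  ultimately show "i = j" using ij by (intro X_unique[of i j "pos i"]) auto
qed

lemma baseA_inj: "i \<le> L \<Longrightarrow> j \<le> L \<Longrightarrow> baseA (i, e) = baseA (j, e') \<Longrightarrow> i = j \<and> e = e'"
proof -
  assume ij: "i \<le> L" "j \<le> L" and eq: "baseA (i, e) = baseA (j, e')"
  have "Tag True (i mod Q) (of_bool e) \<in> baseA (j, e')" unfolding eq[symmetric] by (simp add: baseA_def)
  then have "i mod Q = j mod Q" and "e = e'" by (cases e; cases e'; simp add: baseA_def)+
  moreover have "X i m = X j m" if "m < M" "m \<noteq> pos (i - 1)" for m
    using that by (intro baseA_agree[of i e "{..<M} - {pos (j - 1)}" j "{Tag True (j mod Q) (of_bool e')}"])
      (auto simp: eq, auto simp: baseA_def)
  ultimately show "i = j \<and> e = e'" using ij X_unique[of i j "pos (i - 1)"] by auto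
qed

lemma tagA_no_core: "Core True m x \<notin> tagA k"
  using tagA_props(4)[where k = k] by auto

lemma tagB_no_core: "1 \<le> fst k \<Longrightarrow> Core False m x \<notin> tagB k"
  using tagB_props(4)[where k = k] by auto

lemma one_difference_mod:
  assumes "i \<le> L" "j \<le> L" "\<And>m. m < M \<Longrightarrow> m \<noteq> m0 \<Longrightarrow> X i m = X j m" "X i m0 \<noteq> X j m0"
  shows "i mod Q \<noteq> j mod Q"
  using X_unique[OF assms(1,2,3)] assms(4) by auto

text \<open>Equal words have equal indices and hence equal base tags. Words differing in one block
  have different residues, and \<open>tagA\<close> contains both tags \<open>0\<close> and
  \<open>1\<close> only for its own residue.\<close>

lemma separated_A:
  "separated (side True \<union> side False) (side False) (M * h + 5) ({..<L} \<times> UNIV) dirA (\<lambda>k. baseB (fst k))"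
proof -
  have "separated (side True \<union> side False) (side False) (M * h + 5) ({..<L} \<times> (UNIV :: bool set))
    (\<lambda>k. core True {..<M} (X (fst k)) \<union> tagA k)
    (\<lambda>k. core (\<not> True) ({..<M} - {pos (fst k)}) (X (fst k)) \<union> {Tag False (fst k mod Q) 0})"
  proof (rule separated_words)
    fix k k' :: "nat \<times> bool"
    assume k: "k \<in> {..<L} \<times> UNIV" "k' \<in> {..<L} \<times> UNIV"
    show "pos (fst k) = pos (fst k') \<and> (Tag False (fst k mod Q) 0 = Tag False (fst k' mod Q) 0 \<or>
        3 \<le> card (tagA k - tagA k'))" if "\<And>m. m < M \<Longrightarrow> X (fst k) m = X (fst k') m"
      using X_inj[of "fst k" "fst k'"] that k by auto
    show "Tag False (fst k mod Q) 0 \<noteq> Tag False (fst k' mod Q) 0 \<and> \<not> tagA k \<subseteq> tagA k'"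
      if "m0 < M" "X (fst k) m0 \<noteq> X (fst k') m0" "\<And>m. m < M \<Longrightarrow> m \<noteq> m0 \<Longrightarrow> X (fst k) m = X (fst k') m" for m0
    proof -
      have ne: "fst k mod Q \<noteq> fst k' mod Q"
        using k that by (intro one_difference_mod[where ?m0.0 = m0]) auto
      have "\<not> tagA k \<subseteq> tagA k'"
      proof
        assume "tagA k \<subseteq> tagA k'"
        then have "Tag True (fst k mod Q) 0 \<in> tagA k'" "Tag True (fst k mod Q) 1 \<in> tagA k'"
          by (auto simp: tagA_def split: prod.splits)
        then show False using ne by (cases "snd k'") (auto simp: tagA_def split: prod.splits)
      qed
      then show ?thesis using ne by simp
    qed
  next
    show "core (\<not> True) {..<M} (X (fst k)) \<subseteq> side False" for k :: "nat \<times> bool"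
      using core_side by simp
  qed (use M_ge X_fin X_card X_dist pos_less tagA_props in \<open>auto intro!: Tag_side\<close>)
  moreover have "dirA = (\<lambda>k. core True {..<M} (X (fst k)) \<union> tagA k)"
    "(\<lambda>k :: nat \<times> bool. baseB (fst k)) =
      (\<lambda>k. core (\<not> True) ({..<M} - {pos (fst k)}) (X (fst k)) \<union> {Tag False (fst k mod Q) 0})"
    by (simp_all add: fun_eq_iff dirA_def baseB_def)
  ultimately show ?thesis by (simp only:)
qed

text \<open>Here two cubes can share a word but differ in \<open>e\<close>, and so in their bases;
  the triples \<open>{1, 2, 3}\<close> and \<open>{4, 5, 6}\<close> then provide the three differing
  tags.\<close>

lemma separated_B:
  "separated (side True \<union> side False) (side True) (M * h + 5) ({1..<L} \<times> UNIV) dirB baseA"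
proof -
  have "separated (side True \<union> side False) (side True) (M * h + 5) ({1..<L} \<times> (UNIV :: bool set))
    (\<lambda>k. core False {..<M} (X (fst k)) \<union> tagB k)
    (\<lambda>k. core (\<not> False) ({..<M} - {pos (fst k - 1)}) (X (fst k)) \<union>
      {Tag True (fst k mod Q) (of_bool (snd k))})"
  proof (rule separated_words)
    fix k k' :: "nat \<times> bool"
    assume k: "k \<in> {1..<L} \<times> UNIV" "k' \<in> {1..<L} \<times> UNIV"
    show "pos (fst k - 1) = pos (fst k' - 1) \<and>
        (Tag True (fst k mod Q) (of_bool (snd k)) = Tag True (fst k' mod Q) (of_bool (snd k')) \<or>
        3 \<le> card (tagB k - tagB k'))" if "\<And>m. m < M \<Longrightarrow> X (fst k) m = X (fst k') m"
    proof -
      have eq: "fst k = fst k'" using X_inj[of "fst k" "fst k'"] that k by auto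
      have "3 \<le> card (tagB k - tagB k')" if "snd k \<noteq> snd k'"
      proof -
        have "Tag False (fst k mod Q) ` (if snd k then {1, 2, 3} else {4, 5, 6}) \<subseteq> tagB k - tagB k'"
          using that eq by (cases "snd k") (auto simp: tagB_def split: prod.splits)
        moreover have "card (Tag False (fst k mod Q) ` (if snd k then {1, 2, 3} else {4, 5, 6})) = 3"
          by simp
        moreover have "finite (tagB k - tagB k')" using tagB_props(3)[of k] k by auto
        ultimately show ?thesis by (metis card_mono)
      qed
      then show ?thesis using eq by auto
    qed
    show "Tag True (fst k mod Q) (of_bool (snd k)) \<noteq> Tag True (fst k' mod Q) (of_bool (snd k')) \<and>
        \<not> tagB k \<subseteq> tagB k'"
      if "m0 < M" "X (fst k) m0 \<noteq> X (fst k') m0" "\<And>m. m < M \<Longrightarrow> m \<noteq> m0 \<Longrightarrow> X (fst k) m = X (fst k') m" for m0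
    proof -
      have ne: "fst k mod Q \<noteq> fst k' mod Q"
        using k that by (intro one_difference_mod[where ?m0.0 = m0]) auto
      have "Tag False (fst k mod Q) (if snd k then 1 else 4) \<in> tagB k - tagB k'"
        using ne by (auto simp: tagB_def split: prod.splits)
      then show ?thesis using ne by auto
    qed
  next
    show "core (\<not> False) {..<M} (X (fst k)) \<subseteq> side True" for k :: "nat \<times> bool"
      using core_side by simp
    show "pos (fst k - 1) < M" if "k \<in> {1..<L} \<times> UNIV" for k :: "nat \<times> bool"
      using that by (intro pos_less) auto
  qed (use M_ge X_fin X_card X_dist tagB_props in \<open>auto intro!: Tag_side\<close>)
  moreover have "dirB = (\<lambda>k. core False {..<M} (X (fst k)) \<union> tagB k)"
    "baseA = (\<lambda>k. core (\<not> False) ({..<M} - {pos (fst k - 1)}) (X (fst k)) \<union>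
      {Tag True (fst k mod Q) (of_bool (snd k))})"
    by (simp_all add: fun_eq_iff dirB_def baseA_def)
  ultimately show ?thesis by (simp only:)
qed

lemma base_smaller: "(M - 1) * h + 1 + 2 \<le> M * h + 5"
proof -
  have "(M - 1) * h \<le> M * h" by (rule mult_le_mono1) simp
  then show ?thesis by linarith
qed

lemma psubset_dirA: "1 \<le> j \<Longrightarrow> j \<le> L \<Longrightarrow> baseA (j, e) \<subseteq> dirA k \<Longrightarrow> baseA (j, e) \<subset> dirA k"
  using card_baseA[of j e] card_dirA[of k] base_smaller by (intro psubsetI) auto

lemma psubset_dirB: "i < L \<Longrightarrow> 1 \<le> fst k \<Longrightarrow> baseB i \<subseteq> dirB k \<Longrightarrow> baseB i \<subset> dirB k"
  using card_baseB[of i] card_dirB[of k] base_smaller by (intro psubsetI) auto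

lemma core_omit_subset:
  assumes "\<And>m. m < M \<Longrightarrow> m \<noteq> p \<Longrightarrow> X i m = X j m"
  shows "core s ({..<M} - {p}) (X i) \<subseteq> core s {..<M} (X j)"
  using assms by (auto simp: core_def)

lemma baseA_stay: "baseA (i, e') \<subseteq> dirA (i, e)"
  using core_omit_subset[of "pos (i - 1)" i i True]
  by (cases e') (auto simp: baseA_def dirA_def tagA_def)

lemma baseA_next: "i < L \<Longrightarrow> baseA (Suc i, e) \<subseteq> dirA (i, e)"
  using core_omit_subset[of "pos i" "Suc i" i True] X_step[of i]
  by (auto simp: baseA_def dirA_def tagA_def)

lemma baseA_other: "\<not> baseA (Suc i, \<not> e) \<subseteq> dirA (i, e)"
proof
  assume "baseA (Suc i, \<not> e) \<subseteq> dirA (i, e)"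
  then have "Tag True (Suc i mod Q) (of_bool (\<not> e)) \<in> dirA (i, e)" by (auto simp: baseA_def)
  then show False using mod_Suc_neq[of i] by (cases e) (auto simp: dirA_def tagA_def)
qed

lemma baseB_stay: "baseB i \<subseteq> dirB (i, e)"
  using core_omit_subset[of "pos i" i i False] by (auto simp: baseB_def dirB_def tagB_def)

lemma baseB_prev: "i < L \<Longrightarrow> baseB i \<subseteq> dirB (Suc i, e)"
  using core_omit_subset[of "pos i" i "Suc i" False] X_step[of i]
  by (auto simp: baseB_def dirB_def tagB_def)

text \<open>The tags allow only \<open>j\<close> congruent to \<open>i\<close>, or to
  \<open>Suc i\<close> with \<open>e' = e\<close>. In the first case \<open>baseA\<close> shows that
  the words \<open>j\<close> and \<open>i\<close> agree off one block; in the second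
  \<open>baseB\<close> shows this for \<open>j\<close> and \<open>Suc i\<close>.
  \<open>X_unique\<close> turns congruence into equality.\<close>

lemma crossing:
  assumes "i < L" "1 \<le> j" "j < L" "baseA (j, e') \<subseteq> dirA (i, e)" "baseB i \<subseteq> dirB (j, e')"
  shows "j = i \<or> (j = Suc i \<and> e' = e)"
proof (cases "j mod Q = i mod Q")
  case True
  have "X j m = X i m" if "m < M" "m \<noteq> pos (j - 1)" for m
    using that assms(4) tagA_no_core by (intro baseA_agree[of j e' "{..<M}" i "tagA (i, e)"]) (auto simp: dirA_def)
  then show ?thesis using X_unique[of j i "pos (j - 1)"] True assms by auto
next
  case False
  have "Tag True (j mod Q) (of_bool e') \<in> dirA (i, e)" using assms(4) by (auto simp: baseA_def)
  then have tag: "j mod Q = Suc i mod Q" "e' = e"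
    using False Q_ge by (cases e; cases e'; auto simp: dirA_def tagA_def)+
  have agree: "X i m = X j m" if "m < M" "m \<noteq> pos i" for m
    using that assms tagB_no_core by (intro baseB_agree[of i "{..<M}" j "tagB (j, e')"]) (auto simp: dirB_def)
  have "X j m = X (Suc i) m" if "m < M" "m \<noteq> pos i" for m
    using agree[OF that] X_step[of i m] that assms(1) by simp
  then show ?thesis using X_unique[of j "Suc i" "pos i"] tag assms by auto
qed

sublocale ladder "side True \<union> side False" "side True" "side False" "M * h + 5" "(M - 1) * h + 1" L
  dirA dirB baseA baseB
proof
  show "\<exists>z\<in>baseA l. \<forall>k'\<in>{..<L} \<times> UNIV. baseB (fst k') = baseB (fst k) \<longrightarrow> z \<notin> dirA k'"
    if k: "k \<in> {..<L} \<times> UNIV" and l: "l \<in> {1..<L} \<times> UNIV"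
      and no: "\<And>k'. k' \<in> {..<L} \<times> UNIV \<Longrightarrow> baseB (fst k') = baseB (fst k) \<Longrightarrow> \<not> baseA l \<subseteq> dirA k'" for k l
  proof -
    have same: "fst k' = fst k" if "k' \<in> {..<L} \<times> UNIV" "baseB (fst k') = baseB (fst k)" for k' :: "nat \<times> bool"
      using baseB_inj[of "fst k'" "fst k"] that k by auto
    \<comment> \<open>The cubes over one \<open>baseB\<close> share their core and differ only in
      tags. Either some core element of \<open>baseA l\<close> is outside all of them, or the whole
      core of \<open>baseA l\<close> fits and its tag must be outside all of them.\<close>
    let ?C = "core True ({..<M} - {pos (fst l - 1)}) (X (fst l))" and ?t = "Tag True (fst l mod Q) (of_bool (snd l))"
    show ?thesis
    proof (cases "?C \<subseteq> core True {..<M} (X (fst k))")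
      case True
      have "?t \<notin> dirA k'" if k': "k' \<in> {..<L} \<times> UNIV" "baseB (fst k') = baseB (fst k)" for k'
      proof
        assume "?t \<in> dirA k'"
        then have "baseA l \<subseteq> dirA k'" using True same[OF k'] by (auto simp: baseA_def dirA_def)
        then show False using no[OF k'] by simp
      qed
      then show ?thesis by (intro bexI[of _ ?t]) (auto simp: baseA_def)
    next
      case False
      then obtain z where z: "z \<in> ?C" "z \<notin> core True {..<M} (X (fst k))" by auto
      then obtain m x where "z = Core True m x" by (auto simp: core_def)
      then have "z \<notin> dirA k'" if "k' \<in> {..<L} \<times> UNIV" "baseB (fst k') = baseB (fst k)" for k'
        using z same[OF that] tagA_no_core[of m x k'] by (auto simp: dirA_def)
      then show ?thesis using z by (intro bexI[of _ z]) (auto simp: baseA_def)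
    qed
  qed
  show "\<exists>z\<in>baseB (fst k). \<forall>l'\<in>{1..<L} \<times> UNIV. baseA l' = baseA l \<longrightarrow> z \<notin> dirB l'"
    if k: "k \<in> {..<L} \<times> UNIV" and l: "l \<in> {1..<L} \<times> UNIV"
      and no: "\<And>l'. l' \<in> {1..<L} \<times> UNIV \<Longrightarrow> baseA l' = baseA l \<Longrightarrow> \<not> baseB (fst k) \<subseteq> dirB l'" for k :: "nat \<times> bool" and l
  proof -
    have "\<not> baseB (fst k) \<subseteq> dirB l" using no l by blast
    then obtain z where z: "z \<in> baseB (fst k)" "z \<notin> dirB l" by auto
    have "l' = l" if "l' \<in> {1..<L} \<times> UNIV" "baseA l' = baseA l" for l'
      using baseA_inj[of "fst l'" "fst l" "snd l'" "snd l"] that l by (auto simp: prod_eq_iff)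
    then show ?thesis using z by (intro bexI[of _ z]) auto
  qed
  show "baseA (i, e') \<subset> dirA (i, e)" if "1 \<le> i" "i < L" for i e e'
    using that baseA_stay by (intro psubset_dirA) auto
  show "baseA (Suc i, e) \<subset> dirA (i, e)" if "i < L" for i e
    using that baseA_next by (intro psubset_dirA) auto
  show "baseB i \<subset> dirB (Suc i, e)" if "Suc i < L" for i e
    using that baseB_prev by (intro psubset_dirB) auto
  show "baseB i \<subset> dirB (i, e)" if "1 \<le> i" "i < L" for i e
    using that baseB_stay by (intro psubset_dirB) auto
  show "dirB l \<subseteq> side False" if "l \<in> {1..<L} \<times> UNIV" for l
    using that by (intro dirB_side) auto
  show "2 \<le> (M - 1) * h + 1"
    using M_ge h_pos by simp
  show "(M - 1) * h + 1 + 2 \<le> M * h + 5"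
    by (rule base_smaller)
  show "j = i \<or> (j = Suc i \<and> e' = e)"
    if "i < L" "1 \<le> j" "j < L" "baseA (j, e') \<subseteq> dirA (i, e)" "baseB i \<subseteq> dirB (j, e')" for i j e e'
    using crossing that by blast
  show "i = j \<and> e = e'"
    if "1 \<le> i" "i \<le> L" "1 \<le> j" "j \<le> L" "baseA (i, e) = baseA (j, e')" for i j e e'
    using baseA_inj that by blast
  show "i = j" if "i < L" "j < L" "baseB i = baseB j" for i j
    using baseB_inj that by blast
qed (use finite_side side_disjoint dirA_side dirB_side baseA_side baseB_side card_dirA card_dirB
    card_baseA card_baseB separated_A separated_B baseA_other L_pos' in auto)

end

subsection \<open>Threshold gates as polynomial functions\<close>

lemma mpoly_eval_superset:
  assumes "finite K" "Poly_Mapping.keys p \<subseteq> K"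
  shows "mpoly_eval p x = (\<Sum>m\<in>K. Poly_Mapping.lookup p m *
    (\<Prod>i\<in>Poly_Mapping.keys m. x i ^ Poly_Mapping.lookup m i))"
  unfolding mpoly_eval_def using assms
  by (intro sum.mono_neutral_left) (auto simp: in_keys_iff)

lemma mpoly_eval_add: "mpoly_eval (p + q) x = mpoly_eval p x + mpoly_eval q x"
proof -
  let ?K = "Poly_Mapping.keys p \<union> Poly_Mapping.keys q"
  have "Poly_Mapping.keys (p + q) \<subseteq> ?K" by (rule Poly_Mapping.keys_add)
  then show ?thesis
    by (simp add: mpoly_eval_superset[of ?K] lookup_add distrib_right sum.distrib)
qed

lemma mpoly_vars_add: "mpoly_vars (p + q) \<subseteq> mpoly_vars p \<union> mpoly_vars q"
  using Poly_Mapping.keys_add[of p q] by (fastforce simp: mpoly_vars_def)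

lemma mpoly_degree_le_iff:
  "mpoly_degree p \<le> d \<longleftrightarrow> (\<forall>m\<in>Poly_Mapping.keys p. monom_degree m \<le> d)"
  by (auto simp: mpoly_degree_def)

lemma mpoly_degree_add: "mpoly_degree p \<le> d \<Longrightarrow> mpoly_degree q \<le> d \<Longrightarrow> mpoly_degree (p + q) \<le> d"
  using Poly_Mapping.keys_add[of p q] by (fastforce simp: mpoly_degree_le_iff)

lemma squarefree_monomial:
  assumes "finite S"
  obtains m :: "nat \<Rightarrow>\<^sub>0 nat" where "Poly_Mapping.keys m = S" "\<And>i. i \<in> S \<Longrightarrow> Poly_Mapping.lookup m i = 1"
proof
  have fin: "finite {i. of_bool (i \<in> S) \<noteq> (0::nat)}" using assms by simp
  let ?m = "Abs_poly_mapping (\<lambda>i. of_bool (i \<in> S)) :: nat \<Rightarrow>\<^sub>0 nat"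
  show "Poly_Mapping.keys ?m = S" using fin by (auto simp: in_keys_iff)
  show "Poly_Mapping.lookup ?m i = 1" if "i \<in> S" for i using fin that by simp
qed

lemma prod_of_bool: "finite S \<Longrightarrow> (\<Prod>i\<in>S. of_bool (P i)) = (of_bool (\<forall>i\<in>S. P i) :: int)"
  by (induction rule: finite_induct) auto

lemma polyfn_imp_mpoly:
  assumes "polyfn V d f" "inj_on \<phi> V" "\<phi> ` V \<subseteq> {..<n}"
  shows "\<exists>P. mpoly_vars P \<subseteq> {..<n} \<and> mpoly_degree P \<le> d \<and>
    (\<forall>x\<in>cube n. mpoly_eval P x = f {v \<in> V. x (\<phi> v) = 1})"
  using assms(1)
proof (induction rule: polyfn.induct)
  case (monom S k)
  obtain m :: "nat \<Rightarrow>\<^sub>0 nat" where m: "Poly_Mapping.keys m = \<phi> ` S"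
    "\<And>i. i \<in> \<phi> ` S \<Longrightarrow> Poly_Mapping.lookup m i = 1"
    using squarefree_monomial[of "\<phi> ` S"] monom(2) by auto
  define P where "P = Poly_Mapping.single m k"
  have keys: "Poly_Mapping.keys P \<subseteq> {m}" by (simp add: P_def)
  have "monom_degree m = card (\<phi> ` S)"
    unfolding monom_degree_def m(1) using m(2) by simp
  also have "\<dots> \<le> d" using card_image_le[OF monom(2), of \<phi>] monom(3) by linarith
  finally have "mpoly_degree P \<le> d" using keys by (auto simp: mpoly_degree_le_iff)
  moreover have "mpoly_vars P \<subseteq> {..<n}"
    using keys m(1) monom(1) assms(3) by (fastforce simp: mpoly_vars_def)
  moreover have "mpoly_eval P x = k * of_bool (S \<subseteq> {v \<in> V. x (\<phi> v) = 1})" if x: "x \<in> cube n" for x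
  proof -
    have "mpoly_eval P x = k * (\<Prod>i\<in>\<phi> ` S. x i)"
      using mpoly_eval_superset[OF _ keys, of x] m by (simp add: P_def)
    also have "(\<Prod>i\<in>\<phi> ` S. x i) = (\<Prod>v\<in>S. x (\<phi> v))"
      using inj_on_subset[OF assms(2) monom(1)] by (simp add: prod.reindex)
    also have "\<dots> = (\<Prod>v\<in>S. of_bool (x (\<phi> v) = 1))"
    proof (rule prod.cong[OF refl])
      fix v assume "v \<in> S"
      then have "\<phi> v < n" using monom(1) assms(3) by auto
      then have "x (\<phi> v) \<in> {0, 1}" using x by (auto simp: cube_def PiE_def Pi_def)
      then show "x (\<phi> v) = of_bool (x (\<phi> v) = 1)" by auto
    qed
    also have "\<dots> = of_bool (\<forall>v\<in>S. x (\<phi> v) = 1)" using monom(2) by (rule prod_of_bool)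
    also have "(\<forall>v\<in>S. x (\<phi> v) = 1) \<longleftrightarrow> S \<subseteq> {v \<in> V. x (\<phi> v) = 1}" using monom(1) by auto
    finally show ?thesis .
  qed
  ultimately show ?case by blast
next
  case (add f g)
  then obtain P P' where P: "mpoly_vars P \<subseteq> {..<n}" "mpoly_degree P \<le> d"
      "\<forall>x\<in>cube n. mpoly_eval P x = f {v \<in> V. x (\<phi> v) = 1}"
    and P': "mpoly_vars P' \<subseteq> {..<n}" "mpoly_degree P' \<le> d"
      "\<forall>x\<in>cube n. mpoly_eval P' x = g {v \<in> V. x (\<phi> v) = 1}"
    by auto
  show ?case
    using P P' mpoly_vars_add[of P P'] mpoly_degree_add[of P d P']
    by (intro exI[of _ "P + P'"]) (auto simp: mpoly_eval_add)
qed

definition embed :: "nat \<Rightarrow> ('a \<Rightarrow> nat) \<Rightarrow> 'a set \<Rightarrow> nat \<Rightarrow> int" where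
  "embed n \<phi> X = (\<lambda>i\<in>{..<n}. of_bool (i \<in> \<phi> ` X))"

lemma embed_cube: "embed n \<phi> X \<in> cube n"
  by (auto simp: embed_def cube_def)

text \<open>On 0/1 points positive exponents act as \<open>1\<close>, so a monomial depends only on
  its set of variables, whose size is at most its degree. Monomials with a variable outside the
  image of \<open>\<phi>\<close> vanish, as \<open>embed\<close> sets those variables to
  \<open>0\<close>.\<close>

lemma mpoly_imp_polyfn:
  assumes "mpoly_vars P \<subseteq> {..<n}" "mpoly_degree P \<le> d" "inj_on \<phi> V" "\<phi> ` V \<subseteq> {..<n}"
  shows "polyfn V d (\<lambda>X. mpoly_eval P (embed n \<phi> (X \<inter> V)))"
  unfolding mpoly_eval_def
proof (intro polyfn_sum polyfn_cmult)
  fix m assume m: "m \<in> Poly_Mapping.keys P"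
  let ?K = "Poly_Mapping.keys m"
  have K: "?K \<subseteq> {..<n}" using m assms(1) by (auto simp: mpoly_vars_def)
  have prod: "(\<Prod>i\<in>?K. embed n \<phi> Y i ^ Poly_Mapping.lookup m i) = of_bool (?K \<subseteq> \<phi> ` Y)" for Y
  proof -
    have "(\<Prod>i\<in>?K. embed n \<phi> Y i ^ Poly_Mapping.lookup m i) = (\<Prod>i\<in>?K. of_bool (i \<in> \<phi> ` Y))"
    proof (rule prod.cong[OF refl])
      fix i assume i: "i \<in> ?K"
      then have "i < n" "0 < Poly_Mapping.lookup m i" using K by auto (simp add: in_keys_iff)
      then show "embed n \<phi> Y i ^ Poly_Mapping.lookup m i = of_bool (i \<in> \<phi> ` Y)"
        by (simp add: embed_def zero_power)
    qed
    also have "\<dots> = of_bool (\<forall>i\<in>?K. i \<in> \<phi> ` Y)" by (rule prod_of_bool) simp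
    finally show ?thesis by (simp add: subset_eq)
  qed
  show "polyfn V d (\<lambda>X. \<Prod>i\<in>?K. embed n \<phi> (X \<inter> V) i ^ Poly_Mapping.lookup m i)"
  proof (cases "?K \<subseteq> \<phi> ` V")
    case True
    then obtain S where S: "S \<subseteq> V" "?K = \<phi> ` S" by (auto simp: subset_image_iff)
    have inj: "inj_on \<phi> S" using assms(3) S(1) by (rule inj_on_subset)
    have fin: "finite S" using S(2) finite_imageD[OF _ inj] by (metis finite_keys)
    have "card S = card ?K" using S(2) inj by (simp add: card_image)
    also have "\<dots> \<le> monom_degree m"
      unfolding monom_degree_def card_eq_sum by (intro sum_mono) (simp add: in_keys_iff Suc_leI)
    also have "\<dots> \<le> d" using m assms(2) by (auto simp: mpoly_degree_le_iff)
    finally have "polyfn V d (\<lambda>X. of_bool (S \<subseteq> X))" using S(1) fin by (intro polyfn_subset) auto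
    moreover have "?K \<subseteq> \<phi> ` (X \<inter> V) \<longleftrightarrow> S \<subseteq> X" for X
    proof
      assume sub: "?K \<subseteq> \<phi> ` (X \<inter> V)"
      show "S \<subseteq> X"
      proof
        fix v assume v: "v \<in> S"
        then obtain v' where v': "v' \<in> X \<inter> V" "\<phi> v = \<phi> v'" using sub S(2) by auto
        then have "v = v'" using v S(1) inj_onD[OF assms(3)] by auto
        then show "v \<in> X" using v' by simp
      qed
    qed (use S in auto)
    ultimately show ?thesis by (simp add: prod)
  next
    case False
    then have "\<not> ?K \<subseteq> \<phi> ` (X \<inter> V)" for X by auto
    then show ?thesis by (simp add: prod polyfn_const)
  qed
qed simp

lemma abs_eval_le_weight:
  assumes "mpoly_vars P \<subseteq> {..<n}" "x \<in> cube n"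
  shows "\<bar>mpoly_eval P x\<bar> \<le> int (weight P)"
proof -
  have "\<bar>mpoly_eval P x\<bar> \<le> (\<Sum>m\<in>Poly_Mapping.keys P. \<bar>Poly_Mapping.lookup P m *
      (\<Prod>i\<in>Poly_Mapping.keys m. x i ^ Poly_Mapping.lookup m i)\<bar>)"
    unfolding mpoly_eval_def by (rule sum_abs)
  also have "\<dots> \<le> (\<Sum>m\<in>Poly_Mapping.keys P. \<bar>Poly_Mapping.lookup P m\<bar>)"
  proof (rule sum_mono)
    fix m assume m: "m \<in> Poly_Mapping.keys P"
    have bounds: "0 \<le> x i ^ Poly_Mapping.lookup m i \<and> x i ^ Poly_Mapping.lookup m i \<le> 1"
      if "i \<in> Poly_Mapping.keys m" for i
    proof -
      have "i < n" using that m assms(1) by (auto simp: mpoly_vars_def)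
      then have "x i \<in> {0, 1}" using assms(2) by (auto simp: cube_def PiE_def Pi_def)
      then show ?thesis by (auto simp: power_0_left)
    qed
    have "0 \<le> (\<Prod>i\<in>Poly_Mapping.keys m. x i ^ Poly_Mapping.lookup m i)"
      using bounds by (intro prod_nonneg) auto
    moreover have "(\<Prod>i\<in>Poly_Mapping.keys m. x i ^ Poly_Mapping.lookup m i) \<le> 1"
      using bounds by (intro prod_le_1) auto
    ultimately show "\<bar>Poly_Mapping.lookup P m * (\<Prod>i\<in>Poly_Mapping.keys m. x i ^ Poly_Mapping.lookup m i)\<bar>
        \<le> \<bar>Poly_Mapping.lookup P m\<bar>"
      unfolding abs_mult by (intro mult_left_le) auto
  qed
  also have "\<dots> = int (weight P)" by (simp add: weight_def)
  finally show ?thesis .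
qed

text \<open>If \<open>f\<close> had no threshold gate, all the minima involved would be the same junk value, so the
  bound needs no existence argument.\<close>

lemma min_weight_le:
  assumes "threshold_degree n f \<le> d"
  shows "min_weight n f d \<le> min_weight n f (threshold_degree n f)"
proof (cases "\<exists>p. threshold_gate n f p")
  case True
  have "\<exists>p. threshold_gate n f p \<and> mpoly_degree p = threshold_degree n f"
    unfolding threshold_degree_def by (rule LeastI_ex) (use True in blast)
  then have "\<exists>w p. threshold_gate n f p \<and> mpoly_degree p \<le> threshold_degree n f \<and> weight p = w"
    by auto
  then have "\<exists>p. threshold_gate n f p \<and> mpoly_degree p \<le> threshold_degree n f \<and>
      weight p = min_weight n f (threshold_degree n f)"
    unfolding min_weight_def by (rule LeastI_ex)
  then show ?thesis
    unfolding min_weight_def[of n f d] using assms by (intro Least_le) (meson order_trans)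
next
  case False
  then show ?thesis by (simp add: min_weight_def)
qed

lemma finite_boolean_functions: "finite (boolean_functions n)"
  unfolding boolean_functions_def cube_def by (intro finite_PiE) auto

text \<open>\<open>Max\<close> needs a finite set: for each of the finitely many \<open>f\<close>,
  all values are bounded by the one at the threshold degree.\<close>

lemma min_weight_le_max_weight:
  assumes "f \<in> boolean_functions n" "threshold_degree n f \<le> d"
  shows "min_weight n f d \<le> max_weight n"
proof -
  let ?S = "{min_weight n f d | d f. f \<in> boolean_functions n \<and> threshold_degree n f \<le> d}"
  have "?S \<subseteq> (\<Union>f\<in>boolean_functions n. {..min_weight n f (threshold_degree n f)})"
    using min_weight_le by fastforce
  then have "finite ?S"
    using finite_boolean_functions finite_subset by fastforce
  then show ?thesis unfolding max_weight_def using assms by (intro Max_ge) auto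
qed

text \<open>The function \<open>f\<close> is the sign function of \<open>p\<close>. A minimal-weight
  gate for \<open>f\<close>, read on subsets of \<open>V\<close>, has the signs of \<open>p\<close>,
  so \<open>large\<close> applies, and no value on the cube exceeds the weight.\<close>

theorem max_weight_ge:
  fixes V :: "'a set"
  assumes "finite V" "card V \<le> n" and p: "polyfn V d p"
    and large: "\<And>p'. polyfn V d p' \<Longrightarrow> (\<And>X. X \<subseteq> V \<Longrightarrow> 0 \<le> p X \<longleftrightarrow> 0 \<le> p' X) \<Longrightarrow>
      \<exists>X\<subseteq>V. int b \<le> \<bar>p' X\<bar>"
  shows "b \<le> max_weight n"
proof -
  obtain \<phi> where \<phi>: "inj_on \<phi> V" "\<phi> ` V \<subseteq> {..<n}"
    using card_le_inj[of V "{..<n}"] assms(1,2) by auto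
  obtain P where P: "mpoly_vars P \<subseteq> {..<n}" "mpoly_degree P \<le> d"
    "\<And>x. x \<in> cube n \<Longrightarrow> mpoly_eval P x = p {v \<in> V. x (\<phi> v) = 1}"
    using polyfn_imp_mpoly[OF p \<phi>] by auto
  define f where "f = (\<lambda>x\<in>cube n. of_bool (0 \<le> mpoly_eval P x) :: int)"
  have f_bool: "f \<in> boolean_functions n"
    by (auto simp: f_def boolean_functions_def)
  have gate: "threshold_gate n f P"
    using P(1) by (auto simp: threshold_gate_def f_def)
  have "threshold_degree n f \<le> mpoly_degree P"
    unfolding threshold_degree_def by (rule Least_le) (use gate in blast)
  then have "threshold_degree n f \<le> d" using P(2) by simp
  then have "min_weight n f d \<le> max_weight n" by (rule min_weight_le_max_weight[OF f_bool])
  moreover have "\<exists>P'. threshold_gate n f P' \<and> mpoly_degree P' \<le> d \<and> weight P' = min_weight n f d"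
    unfolding min_weight_def by (rule LeastI_ex) (use gate P(2) in blast)
  then obtain P' where P': "threshold_gate n f P'" "mpoly_degree P' \<le> d" "weight P' = min_weight n f d"
    by blast
  have vars': "mpoly_vars P' \<subseteq> {..<n}" using P'(1) by (simp add: threshold_gate_def)
  define p' where "p' = (\<lambda>X. mpoly_eval P' (embed n \<phi> (X \<inter> V)))"
  have "\<exists>X\<subseteq>V. int b \<le> \<bar>p' X\<bar>"
  proof (rule large)
    show "polyfn V d p'"
      unfolding p'_def using vars' P'(2) \<phi> by (rule mpoly_imp_polyfn)
    show "0 \<le> p X \<longleftrightarrow> 0 \<le> p' X" if X: "X \<subseteq> V" for X
    proof -
      let ?x = "embed n \<phi> X"
      have x: "?x \<in> cube n" by (rule embed_cube)
      have "{v \<in> V. ?x (\<phi> v) = 1} = X"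
        using X \<phi> by (auto simp: embed_def dest: inj_onD)
      then have "0 \<le> p X \<longleftrightarrow> f ?x = 1" using P(3)[OF x] x by (simp add: f_def)
      also have "\<dots> \<longleftrightarrow> 0 \<le> mpoly_eval P' ?x" using P'(1) x by (simp add: threshold_gate_def)
      finally show ?thesis using X by (simp add: p'_def Int_absorb2)
    qed
  qed
  then obtain X where "X \<subseteq> V" "int b \<le> \<bar>p' X\<bar>" by blast
  moreover have "\<bar>p' X\<bar> \<le> int (weight P')"
    unfolding p'_def by (rule abs_eval_le_weight[OF vars' embed_cube])
  ultimately show ?thesis using P'(3) by linarith
qed

subsection \<open>Gray codes and packings\<close>

text \<open>The modular \<open>Q\<close>-ary Gray code: digit \<open>m\<close> of \<open>i\<close>
  minus digit \<open>m + 1\<close>, modulo \<open>Q\<close>, with \<open>- 1\<close> written as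
  \<open>Q - 1\<close> to stay in the naturals.\<close>

definition gray :: "nat \<Rightarrow> nat \<Rightarrow> nat \<Rightarrow> nat" where
  "gray Q m i = (i div Q ^ m + (Q - 1) * (i div Q ^ Suc m)) mod Q"

lemma gray_recover:
  assumes "0 < Q"
  shows "(gray Q m i + i div Q ^ Suc m) mod Q = (i div Q ^ m) mod Q"
proof -
  define a where "a = i div Q ^ m"
  define b where "b = i div Q ^ Suc m"
  have "(gray Q m i + b) mod Q = (a + (Q - 1) * b + b) mod Q"
    unfolding gray_def a_def b_def by (simp only: mod_add_left_eq)
  also have "a + (Q - 1) * b + b = a + Q * b" using assms by (cases Q) auto
  finally show ?thesis by (simp add: a_def b_def)
qed

text \<open>The digit differences telescope. For \<open>i < Q ^ M\<close> the quotient is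
  \<open>0\<close>, so the digit sum of the code word is congruent to \<open>i\<close>.\<close>

lemma gray_sum:
  assumes "0 < Q"
  shows "((\<Sum>m<M. gray Q m i) + i div Q ^ M) mod Q = i mod Q"
proof (induction M)
  case (Suc M)
  have "((\<Sum>m<Suc M. gray Q m i) + i div Q ^ Suc M) mod Q
      = ((\<Sum>m<M. gray Q m i) + (gray Q M i + i div Q ^ Suc M)) mod Q"
    by (simp add: add.assoc)
  also have "\<dots> = ((\<Sum>m<M. gray Q m i) + (gray Q M i + i div Q ^ Suc M) mod Q) mod Q"
    by (simp only: mod_add_right_eq)
  also have "\<dots> = ((\<Sum>m<M. gray Q m i) + i div Q ^ M) mod Q"
    unfolding gray_recover[OF assms] by (simp only: mod_add_right_eq)
  finally show ?case using Suc by simp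
qed simp

text \<open>The quotients \<open>i div Q ^ m\<close> are recovered downwards from
  \<open>m = M\<close>, where they are \<open>0\<close>.\<close>

lemma gray_inj:
  assumes "0 < Q" "i < Q ^ M" "j < Q ^ M" "\<And>m. m < M \<Longrightarrow> gray Q m i = gray Q m j"
  shows "i = j"
proof -
  have "i div Q ^ m = j div Q ^ m" if "m \<le> M" for m
    using that
  proof (induction rule: inc_induct)
    case base
    then show ?case using assms by simp
  next
    case (step m)
    have "(i div Q ^ m) mod Q = (j div Q ^ m) mod Q"
      using gray_recover[OF assms(1), of m i] gray_recover[OF assms(1), of m j] assms(4)[of m] step by simp
    moreover have "i div Q ^ m div Q = j div Q ^ m div Q"
      using step by (simp flip: div_mult2_eq add: mult.commute)
    ultimately show ?case by (metis div_mult_mod_eq)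
  qed
  from this[of 0] show ?thesis by simp
qed

lemma mod_add_cancel:
  fixes x y z k :: nat
  assumes "(x + z) mod k = (y + z) mod k" "x < k" "y < k"
  shows "x = y"
  using assms
proof (induction x y rule: linorder_wlog)
  case (le x y)
  then have "k dvd (y + z) - (x + z)" using mod_eq_dvd_iff_nat[of "x + z" "y + z" k] by simp
  then have "k dvd y - x" by simp
  then have "y - x = 0" using le by (metis less_imp_diff_less nat_dvd_not_less neq0_conv)
  then show ?case using le by simp
qed simp

text \<open>By \<open>gray_sum\<close>, the residue of the index and the other digits determine the
  missing digit.\<close>

lemma gray_unique:
  assumes Q: "0 < Q" and ij: "i < Q ^ M" "j < Q ^ M"
    and agree: "\<And>m. m < M \<Longrightarrow> m \<noteq> m0 \<Longrightarrow> gray Q m i = gray Q m j" and "i mod Q = j mod Q"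
  shows "i = j"
proof (rule gray_inj[OF Q ij])
  fix m assume m: "m < M"
  show "gray Q m i = gray Q m j"
  proof (cases "m = m0")
    case True
    let ?R = "\<lambda>i. \<Sum>l\<in>{..<M} - {m}. gray Q l i"
    have split: "(gray Q m i + ?R i) mod Q = i mod Q" if "i < Q ^ M" for i
      using gray_sum[OF Q, of i M] sum.remove[of "{..<M}" m "\<lambda>l. gray Q l i"] m that by simp
    have "?R i = ?R j" using agree True by (intro sum.cong) auto
    then have "(gray Q m i + ?R i) mod Q = (gray Q m j + ?R i) mod Q"
      using split[OF ij(1)] split[OF ij(2)] assms(5) by simp
    then show ?thesis by (rule mod_add_cancel) (simp_all add: gray_def Q)
  qed (use agree m in auto)
qed

text \<open>\<open>m0\<close> is the largest exponent with \<open>Q ^ m0\<close> dividing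
  \<open>Suc i\<close>. Below it both quotients in \<open>gray\<close> grow by one, adding
  \<open>Q\<close>; above it neither changes. Divisibility is recorded because it later bounds
  \<open>m0\<close> by \<open>M\<close>.\<close>

lemma gray_step:
  assumes "2 \<le> Q"
  shows "\<exists>m0. Q ^ m0 dvd Suc i \<and> (\<forall>m. m \<noteq> m0 \<longrightarrow> gray Q m (Suc i) = gray Q m i)"
proof -
  have ex: "\<exists>m. \<not> Q ^ Suc m dvd Suc i"
  proof
    have "Suc i < Q ^ Suc i" using assms by (intro less_le_trans[OF less_exp power_mono]) auto
    also have "Q ^ Suc i \<le> Q ^ Suc (Suc i)" using assms by (intro power_increasing) auto
    finally show "\<not> Q ^ Suc (Suc i) dvd Suc i" by (metis dvd_imp_le not_less zero_less_Suc)
  qed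
  define m0 where "m0 = (LEAST m. \<not> Q ^ Suc m dvd Suc i)"
  have m0: "\<not> Q ^ Suc m0 dvd Suc i" unfolding m0_def using ex by (rule LeastI_ex)
  have low: "Q ^ m dvd Suc i" if "m \<le> m0" for m
  proof (cases m)
    case (Suc l)
    then show ?thesis using not_less_Least[of l "\<lambda>m. \<not> Q ^ Suc m dvd Suc i"] that by (simp add: m0_def)
  qed simp
  have high: "\<not> Q ^ m dvd Suc i" if "m0 < m" for m
    using m0 dvd_trans[OF le_imp_power_dvd[of "Suc m0" m Q]] that by auto
  have div: "Suc i div Q ^ m = (if m \<le> m0 then Suc (i div Q ^ m) else i div Q ^ m)" for m
    using low[of m] high[of m] div_Suc[of i "Q ^ m"] by (simp add: mod_eq_0_iff_dvd not_le)
  have "gray Q m (Suc i) = gray Q m i" if "m \<noteq> m0" for m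
  proof (cases "m < m0")
    case True
    define a where "a = i div Q ^ m"
    define b where "b = i div Q ^ Suc m"
    have "gray Q m (Suc i) = (Suc a + (Q - 1) * Suc b) mod Q"
      using True by (simp only: gray_def div a_def b_def) simp
    also have "Suc a + (Q - 1) * Suc b = a + (Q - 1) * b + Q" using assms by (cases Q) auto
    finally show ?thesis by (simp add: gray_def a_def b_def)
  next
    case False
    then show ?thesis using that by (simp only: gray_def div) simp
  qed
  then show ?thesis using low by blast
qed

section \<open>Constant-weight codes by a maximality argument\<close>

text \<open>The value \<open>n\<close>, outside \<open>{..<n}\<close>, serves as a blank, so sets of
  size at most two are parametrised by pairs.\<close>

lemma small_set_eq_pair:
  fixes Z :: "nat set"
  assumes "Z \<subseteq> {..<n}" "card Z \<le> 2"
  shows "\<exists>x\<le>n. \<exists>y\<le>n. Z = {x, y} \<inter> {..<n}"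
proof -
  have fin: "finite Z" using assms(1) finite_subset by blast
  consider "Z = {}" | x where "Z = {x}" | x y where "Z = {x, y}"
  proof -
    consider "card Z = 0" | "card Z = 1" | "card Z = 2" using assms(2) by linarith
    then show thesis
      using fin that by cases (auto simp: card_1_singleton_iff card_2_iff)
  qed
  then show ?thesis
  proof cases
    case 1
    then show ?thesis by (intro exI[of _ n]) auto
  next
    case (2 x)
    then show ?thesis using assms(1) by (intro exI[of _ x]) auto
  next
    case (3 x y)
    then show ?thesis using assms(1) by (intro exI[of _ x] conjI exI[of _ y]) auto
  qed
qed

text \<open>A constant-weight code of Hamming distance at least \<open>6\<close>; the
  \<open>3\<close> is the gap that \<open>sum_blocks_le\<close> requires of a differing
  block.\<close>

definition packing :: "nat \<Rightarrow> nat \<Rightarrow> nat set set \<Rightarrow> bool" where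
  "packing n h C \<longleftrightarrow> (\<forall>c\<in>C. c \<subseteq> {..<n} \<and> card c = h) \<and>
     (\<forall>c\<in>C. \<forall>c'\<in>C. c \<noteq> c' \<longrightarrow> card (c \<inter> c') + 3 \<le> h)"

text \<open>A Gilbert-Varshamov argument: by maximality each \<open>h\<close>-set arises from some
  codeword by removing and adding at most two elements, and the four choices give at most
  \<open>(n + 1) ^ 4\<close> sets per codeword.\<close>

lemma large_packing:
  "\<exists>C. packing n h C \<and> n choose h \<le> card C * (n + 1) ^ 4"
proof -
  let ?S = "{c. c \<subseteq> {..<n} \<and> card c = h}"
  have finS: "finite ?S" by (rule finite_subset[of _ "Pow {..<n}"]) auto
  have "finite {C. packing n h C}"
    by (rule finite_subset[of _ "Pow ?S"]) (use finS in \<open>auto simp: packing_def\<close>)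
  moreover have "packing n h {}" by (simp add: packing_def)
  ultimately have "\<exists>C\<in>{C. packing n h C}. {} \<subseteq> C \<and> (\<forall>C'\<in>{C. packing n h C}. C \<subseteq> C' \<longrightarrow> C = C')"
    by (intro finite_has_maximal2) auto
  then obtain C where C: "packing n h C" and max: "\<And>C'. packing n h C' \<Longrightarrow> C \<subseteq> C' \<Longrightarrow> C = C'"
    by (elim bexE conjE) simp
  have CS: "C \<subseteq> ?S" using C by (auto simp: packing_def)
  have finC: "finite C" using CS finS finite_subset by blast
  define ball where "ball = (\<lambda>c. (\<lambda>((x, y), (z, w)). c - {x, y} \<union> {z, w} \<inter> {..<n}) `
    (({..n} \<times> {..n}) \<times> ({..n} \<times> {..n})))"
  have card_ball: "card (ball c) \<le> (n + 1) ^ 4" for c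
  proof -
    have "card (ball c) \<le> card (({..n} \<times> {..n}) \<times> ({..n} \<times> {..n}))"
      unfolding ball_def by (rule card_image_le) simp
    also have "\<dots> = (n + 1) ^ 4" by (simp only: card_cartesian_product card_atMost power4_eq_xxxx Suc_eq_plus1 mult.assoc)
    finally show ?thesis .
  qed
  have "?S \<subseteq> (\<Union>c\<in>C. ball c)"
  proof
    fix T assume T: "T \<in> ?S"
    have "\<exists>c\<in>C. h < card (T \<inter> c) + 3"
    proof (cases "T \<in> C")
      case True
      then show ?thesis using T by (intro bexI[of _ T]) auto
    next
      case False
      show ?thesis
      proof (rule ccontr)
        assume "\<not> ?thesis"
        then have "packing n h (insert T C)"
          using C T by (auto simp: packing_def Int_commute not_less)
        then show False using max[of "insert T C"] False by auto
      qed
    qed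
    then obtain c where c: "c \<in> C" "h < card (T \<inter> c) + 3" by blast
    have cp: "c \<subseteq> {..<n}" "card c = h" using c CS by auto
    have Tp: "T \<subseteq> {..<n}" "card T = h" using T by auto
    have fin: "finite c" "finite T" using cp Tp finite_subset by blast+
    have "card (c - T) \<le> 2" "card (T - c) \<le> 2"
      using c(2) fin cp Tp card_Diff_subset_Int[of c T] card_Diff_subset_Int[of T c]
      by (simp_all add: Int_commute)
    then obtain x y z w where xy: "x \<le> n" "y \<le> n" "c - T = {x, y} \<inter> {..<n}"
      and zw: "z \<le> n" "w \<le> n" "T - c = {z, w} \<inter> {..<n}"
      using small_set_eq_pair[of "c - T" n] small_set_eq_pair[of "T - c" n] cp Tp by blast
    have "c - {x, y} = c - (c - T)" unfolding xy(3) using cp(1) by auto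
    then have "T = c - {x, y} \<union> {z, w} \<inter> {..<n}" unfolding zw(3)[symmetric] by auto
    then have "T \<in> ball c"
      unfolding ball_def using xy zw by (intro image_eqI[where x = "((x, y), (z, w))"]) auto
    then show "T \<in> (\<Union>c\<in>C. ball c)" using c(1) by blast
  qed
  then have "card ?S \<le> card (\<Union>c\<in>C. ball c)"
    using finC by (intro card_mono) (auto simp: ball_def)
  also have "\<dots> \<le> (\<Sum>c\<in>C. card (ball c))" using finC by (rule card_UN_le)
  also have "\<dots> \<le> card C * (n + 1) ^ 4"
    using sum_bounded_above[of C "\<lambda>c. card (ball c)"] card_ball by auto
  finally have "n choose h \<le> card C * (n + 1) ^ 4" using n_subsets[of "{..<n}" h] by simp
  then show ?thesis using C by blast
qed

text \<open>A block of \<open>200\<close> elements on two sides costs \<open>400\<close> variables,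
  and \<open>160 / 400\<close> is the exponent \<open>2 / 5\<close>. Length \<open>200\<close>
  suffices because the loss \<open>200 * 201 ^ 4\<close> is below \<open>2 ^ 40\<close>.\<close>

lemma packing_200_100: "\<exists>C. packing 200 100 C \<and> 2 ^ 160 \<le> card C"
proof -
  obtain C where C: "packing 200 100 C" "(200::nat) choose 100 \<le> card C * 201 ^ 4"
    using large_packing[of 200 100] by auto
  have "(4::real) ^ 100 / (2 * real 100) \<le> real ((2 * 100) choose 100)"
    by (rule central_binomial_lower_bound) simp
  also have "\<dots> \<le> real (card C * 201 ^ 4)" using C(2) by (subst of_nat_le_iff) simp
  finally have "(4::real) ^ 100 / 200 \<le> real (card C) * 201 ^ 4" by simp
  then have "(2 ^ 160 :: real) \<le> real (card C)" by simp
  then have "2 ^ 160 \<le> card C" by (metis of_nat_le_iff of_nat_numeral of_nat_power)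
  then show ?thesis using C(1) by blast
qed

section \<open>Choice of parameters and the final bound\<close>

lemma max_weight_exponential:
  assumes C: "packing q h C" "card C = Q" and "2 \<le> Q" "0 < h" "2 \<le> M" and n: "2 * (M * q + 7 * Q) \<le> n"
  shows "2 ^ (Q ^ M - 2) \<le> max_weight n"
proof -
  have "finite C" using assms(2,3) card.infinite by fastforce
  then obtain c where c: "bij_betw c {0..<Q} C"
    using ex_bij_betw_nat_finite[of C] C(2) by auto
  have cC: "c r \<in> C" if "r < Q" for r using c that by (auto simp: bij_betw_def)
  have c_inj: "r = r'" if "r < Q" "r' < Q" "c r = c r'" for r r'
    using c that by (auto simp: bij_betw_def dest: inj_onD)
  have gray_less: "gray Q m i < Q" for m i using \<open>2 \<le> Q\<close> by (simp add: gray_def)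
  have "\<forall>i. \<exists>m0. Q ^ m0 dvd Suc i \<and> (\<forall>m. m \<noteq> m0 \<longrightarrow> gray Q m (Suc i) = gray Q m i)"
    by (intro allI gray_step assms)
  from choice[OF this] obtain pos where "\<forall>i. Q ^ pos i dvd Suc i \<and> (\<forall>m. m \<noteq> pos i \<longrightarrow> gray Q m (Suc i) = gray Q m i)"
    by (elim exE)
  then have pos: "Q ^ pos i dvd Suc i" "m \<noteq> pos i \<Longrightarrow> gray Q m (Suc i) = gray Q m i" for i m
    by simp_all
  define X where "X = (\<lambda>i m. c (gray Q m i))"
  have X_digit: "gray Q m i = gray Q m j" if "X i m = X j m" for i j m
    using that c_inj[OF gray_less gray_less] by (simp add: X_def)
  \<comment> \<open>The words \<open>0\<close> to \<open>L\<close> are exactly the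
    \<open>Q ^ M\<close> Gray code words; the ladder uses the last one only as an end point.\<close>
  define L where "L = Q ^ M - 1"
  have QM: "4 \<le> Q ^ M"
  proof -
    have "(2::nat) ^ 2 \<le> Q ^ 2" using \<open>2 \<le> Q\<close> by (rule power_mono) simp
    also have "\<dots> \<le> Q ^ M" using \<open>2 \<le> M\<close> \<open>2 \<le> Q\<close> by (intro power_increasing) auto
    finally show ?thesis by simp
  qed
  interpret word_sequence M Q q h L X pos
  proof
    show "pos i < M" if "i < L" for i
    proof -
      have "Q ^ pos i \<le> Suc i" using pos(1)[of i] by (intro dvd_imp_le) auto
      also have "\<dots> < Q ^ M" using that by (simp add: L_def)
      finally show ?thesis using \<open>2 \<le> Q\<close> by (simp add: power_strict_increasing_iff)
    qed
    have le_L: "i < Q ^ M" if "i \<le> L" for i using that QM by (simp add: L_def)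
    show "i = j" if ij: "i \<le> L" "j \<le> L" and eq: "\<And>m. m < M \<Longrightarrow> X i m = X j m" for i j
    proof (rule gray_inj)
      show "0 < Q" using \<open>2 \<le> Q\<close> by simp
      show "i < Q ^ M" "j < Q ^ M" using ij by (simp_all add: le_L)
      show "gray Q m i = gray Q m j" if "m < M" for m by (rule X_digit[OF eq[OF that]])
    qed
    show "i = j" if ij: "i \<le> L" "j \<le> L" and eq: "\<And>m. m < M \<Longrightarrow> m \<noteq> m0 \<Longrightarrow> X i m = X j m"
      and mod: "i mod Q = j mod Q" for i j m0
    proof (rule gray_unique)
      show "0 < Q" using \<open>2 \<le> Q\<close> by simp
      show "i < Q ^ M" "j < Q ^ M" using ij by (simp_all add: le_L)
      show "gray Q m i = gray Q m j" if "m < M" "m \<noteq> m0" for m by (rule X_digit[OF eq[OF that]])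
    qed (fact mod)
    show "card (X i m \<inter> X j m) + 3 \<le> h" if "X i m \<noteq> X j m" for i j m
      using that C(1) cC gray_less by (simp add: packing_def X_def)
    show "X i m \<subseteq> {..<q}" "card (X i m) = h" for i m
      using C(1) cC gray_less by (simp_all add: packing_def X_def)
    show "X (Suc i) m = X i m" if "m \<noteq> pos i" for i m
      using pos(2)[OF that] by (simp add: X_def)
    show "0 < L" using QM by (simp add: L_def)
  qed (use assms in auto)
  let ?V = "side True \<union> side False" and ?d = "M * h + 5 - 1"
  obtain p where p: "polyfn ?V ?d p" and
    large: "\<forall>p'. polyfn ?V ?d p' \<and> (\<forall>X. X \<subseteq> ?V \<longrightarrow> (0 \<le> p X \<longleftrightarrow> 0 \<le> p' X)) \<longrightarrow>
      (\<exists>X. X \<subseteq> ?V \<and> 2 ^ (L - 1) \<le> \<bar>p' X\<bar>)"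
    using exponential_values by (elim exE conjE)
  have "2 ^ (L - 1) \<le> max_weight n"
  proof (rule max_weight_ge[OF _ _ p])
    show "finite ?V" using finite_side by simp
    show "card ?V \<le> n"
      using card_Un_le[of "side True" "side False"] card_side_le[of True] card_side_le[of False] n
      unfolding mult_2 by linarith
    show "\<exists>X\<subseteq>?V. int (2 ^ (L - 1)) \<le> \<bar>p' X\<bar>"
      if "polyfn ?V ?d p'" "\<And>X. X \<subseteq> ?V \<Longrightarrow> 0 \<le> p X \<longleftrightarrow> 0 \<le> p' X" for p'
      using large[rule_format, of p'] that by simp
  qed
  then show ?thesis by (simp add: L_def numeral_2_eq_2)
qed

theorem theorem1p1:
  "\<exists>c::real. c > 0 \<and>
     (\<exists>N::nat. \<forall>n\<ge>N. real (max_weight n) \<ge> 2 powr (c * 2 powr (2 * real n / 5)))"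
proof -
  obtain C where C: "packing 200 100 C" "2 ^ 160 \<le> card C" using packing_200_100 by blast
  define Q where "Q = card C"
  have Q: "2 ^ 160 \<le> Q" using C(2) by (simp add: Q_def)
  then have Q2: "2 \<le> Q" by simp
  define K where "K = 28 * real Q / 5 + 160"
  \<comment> \<open>The additional \<open>- 1\<close> pays for replacing \<open>Q ^ M - 2\<close> by
    half of \<open>Q ^ M\<close>.\<close>
  define c where "c = 2 powr (- K - 1)"
  have "real (max_weight n) \<ge> 2 powr (c * 2 powr (2 * real n / 5))" if n: "14 * Q + 800 \<le> n" for n
  proof -
    \<comment> \<open>\<open>14 * Q\<close> variables hold the seven tags per residue on both sides;
      each block takes \<open>200\<close> variables per side.\<close>
    define M where "M = (n - 14 * Q) div 400"
    have M2: "2 \<le> M" unfolding M_def using n by linarith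
    have M_le: "400 * M + 14 * Q \<le> n" "n < 400 * M + 400 + 14 * Q"
      unfolding M_def using n by linarith+
    have "2 ^ (Q ^ M - 2) \<le> max_weight n"
      using M_le(1) by (intro max_weight_exponential[OF C(1) Q_def[symmetric] Q2 _ M2]) simp_all
    then have "real (2 ^ (Q ^ M - 2)) \<le> real (max_weight n)" by (rule of_nat_mono)
    then have weight: "2 powr real (Q ^ M - 2) \<le> real (max_weight n)"
      by (simp only: of_nat_power of_nat_numeral powr_realpow zero_less_numeral)
    have "(2 * real n / 5) - K \<le> 160 * real M"
      using M_le(2) unfolding K_def by linarith
    then have "2 powr ((2 * real n / 5) - K) \<le> 2 powr (160 * real M)" by simp
    also have "\<dots> = (2 ^ 160) ^ M"
      by (simp add: powr_realpow flip: powr_powr)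
    also have "\<dots> \<le> real Q ^ M"
      using Q by (intro power_mono) (metis of_nat_le_iff of_nat_numeral of_nat_power, simp)
    finally have QM: "2 powr ((2 * real n / 5) - K) \<le> real (Q ^ M)" by simp
    have "(2::nat) ^ 2 \<le> Q ^ 2" using Q2 by (rule power_mono) simp
    also have "\<dots> \<le> Q ^ M" using M2 Q2 by (intro power_increasing) auto
    finally have "4 \<le> Q ^ M" by simp
    then have "real (Q ^ M) / 2 \<le> real (Q ^ M - 2)" by linarith
    moreover have "c * 2 powr (2 * real n / 5) = 2 powr ((2 * real n / 5) - K) / 2"
      unfolding c_def by (simp add: powr_diff powr_minus field_simps flip: powr_add)
    ultimately have "c * 2 powr (2 * real n / 5) \<le> real (Q ^ M - 2)" using QM by linarith
    then have "2 powr (c * 2 powr (2 * real n / 5)) \<le> 2 powr real (Q ^ M - 2)" by simp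
    then show ?thesis using weight by linarith
  qed
  moreover have "0 < c" by (simp add: c_def)
  ultimately show ?thesis by blast
qed

end
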